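(* Let $p$ be an odd prime with $p - 1 = 2 q_1 \cdots q_k$ for some $k \ge 0$ and distinct odd primes $q_1, \dots, q_k$, and let $n = 2p$. Then the number of exponential orthomorphisms modulo $n$ is at least \[ \frac{(k+2)! \cdot 3^{k+1} \cdot 2^{n-2^{k-1}}}{4(n-2)^{3 \cdot 2^{k-1}}}. \]
   Context: For an integer $n \ge 2$, an exponential orthomorphism modulo $n$ is a permutation $\sigma$ of $\{1, \dots, n-1\}$ such that the map $x \mapsto x^{\sigma(x)} \bmod n$ is also a bijection of $\{1, \dots, n-1\}$ (residues taken in $\{0,\dots,n-1\}$). *)

theory Defs
  imports Complex_Main "HOL-Computational_Algebra.Primes" "HOL-Combinatorics.Permutations"
begin

text \<open>
  Since \<open>permutes\<close> forces \<open>\<sigma>\<close> to be the identity outside \<open>{1..n - 1}\<close>, each permutation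
  of \<open>{1..n - 1}\<close> is represented by exactly one function, so cardinalities are the expected
  ones.  The notion is meant for \<open>n \<ge> 2\<close>.
\<close>
definition exponential_orthomorphism :: "nat \<Rightarrow> (nat \<Rightarrow> nat) \<Rightarrow> bool" where
  "exponential_orthomorphism n \<sigma> \<longleftrightarrow>
     \<sigma> permutes {1..n - 1} \<and>
     bij_betw (\<lambda>x. x ^ \<sigma> x mod n) {1..n - 1} {1..n - 1}"

end

theory Submission
  imports
    Defs
    "HOL-Algebra.Coset"
    "HOL-Analysis.Convex"
    "HOL-Computational_Algebra.Squarefree"
    "HOL-Number_Theory.Residue_Primitive_Roots"
begin

text \<open>
  Put \<open>m = p - 1\<close>.  A primitive root modulo \<open>p\<close> turns the nonzero residues modulo \<open>2 p\<close> other than \<open>p\<close>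
  into two copies of \<open>\<int>/m\<close> on which the exponent \<open>e\<close> acts as multiplication by \<open>e\<close>.  As \<open>m\<close> is
  squarefree, for each factorisation \<open>m = c d\<close> the elements of \<open>\<int>/m\<close> with \<open>gcd l m = c\<close> form a copy of
  the unit group \<open>G\<close> of \<open>\<int>/d\<close>.  Once \<open>p\<close> has taken one exponent, those with \<open>gcd e m = c\<close> act on it as the elements of \<open>G\<close>,
  each unit being represented by exactly two of them.  So it suffices to distribute two copies of
  every element of a finite abelian group \<open>G\<close> over two copies of \<open>G\<close> such that \<open>u \<mapsto> u s(u)\<close> permutes
  each copy.  By a theorem of M. Hall (1952) this is possible for every split of the elements into
  two halves with product \<open>1\<close>, and a Cauchy-Schwarz argument on subsets of equal size and equal
  product provides at least \<open>4 ^ |G| / (2 |G|\<^sup>2)\<close> such splits.  Together with translations this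
  gives \<open>4 ^ |G| / 2\<close> solutions for each of the \<open>2 ^ (k + 1)\<close> divisors \<open>d\<close> of \<open>m\<close>, hence
  \<open>3 * 4 ^ m / 2 ^ 2 ^ (k + 1)\<close> exponential orthomorphisms in total.  The claimed bound is smaller,
  because \<open>(k + 2)! * 3 ^ k \<le> m ^ (2 k + 1) \<le> m powr (3 * 2 powr (k - 1))\<close>.
\<close>

section \<open>Hall's theorem on finite abelian groups\<close>

text \<open>
  The defect at \<open>a\<close> and \<open>c\<close> is removed by shifting \<open>\<rho>\<close> along the orbit of \<open>a\<close> under the
  permutation \<open>\<tau>\<close> of \<open>I\<close> with \<open>f (\<tau> x) \<otimes> \<rho> x = K\<close>, up to its first return to \<open>{a, c}\<close>.  Along
  this orbit \<open>K = \<rho> (j i) \<otimes> b (j i) \<otimes> \<rho> (j (i - 1))\<close>, with \<open>c\<close> in the role of \<open>j (- 1)\<close>, so the shifted \<open>\<rho>\<close> meets the value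
  \<open>f (j (i + 1))\<close> at \<open>j i\<close>.
\<close>
lemma hall_exchange:
  fixes G (structure)
  assumes "comm_group G" "finite (carrier G)" "finite I"
    and b: "b \<in> I \<rightarrow> carrier G"
    and rho: "bij_betw \<rho> I (carrier G)" and f: "bij_betw f I (carrier G)"
    and ac: "a \<in> I" "c \<in> I" "a \<noteq> c"
    and eq: "\<And>x. x \<in> I - {a, c} \<Longrightarrow> f x = \<rho> x \<otimes> b x"
    and prod: "f a \<otimes> f c = (\<rho> a \<otimes> \<rho> c) \<otimes> (b a \<otimes> b c)"
  shows "\<exists>\<rho>'. bij_betw \<rho>' I (carrier G) \<and> bij_betw (\<lambda>x. \<rho>' x \<otimes> b x) I (carrier G)"
proof -
  interpret comm_group G by fact
  have rc [simp]: "x \<in> I \<Longrightarrow> \<rho> x \<in> carrier G" for x using rho by (auto simp: bij_betw_def)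
  have fc [simp]: "x \<in> I \<Longrightarrow> f x \<in> carrier G" for x using f by (auto simp: bij_betw_def)
  have bc [simp]: "x \<in> I \<Longrightarrow> b x \<in> carrier G" for x using b by auto
  have card_I: "card I = card (carrier G)" using rho by (simp add: bij_betw_same_card)
  \<comment> \<open>\<open>K\<close> is chosen so that
    \<open>f (\<tau> a) = \<rho> c \<otimes> b a\<close>: at the starting point \<open>a\<close>,
    the shifted solution can use \<open>\<rho> c\<close>.\<close>
  define K where "K = \<rho> a \<otimes> \<rho> c \<otimes> b a"
  have Kc [simp]: "K \<in> carrier G" using ac by (simp add: K_def)
  define \<tau> where "\<tau> x = inv_into I f (K \<otimes> inv (\<rho> x))" for x
  have f\<tau>: "f (\<tau> x) = K \<otimes> inv (\<rho> x)" if "x \<in> I" for x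
    unfolding \<tau>_def using that f by (intro f_inv_into_f) (auto simp: bij_betw_def)
  have \<tau>I: "\<tau> x \<in> I" if "x \<in> I" for x
    unfolding \<tau>_def using that f by (intro inv_into_into) (auto simp: bij_betw_def)
  have \<tau>inj: "inj_on \<tau> I"
  proof (rule inj_onI)
    fix x y assume xy: "x \<in> I" "y \<in> I" "\<tau> x = \<tau> y"
    then have "K \<otimes> inv (\<rho> x) = K \<otimes> inv (\<rho> y)" using f\<tau> by metis
    then have "inv (\<rho> x) = inv (\<rho> y)" using xy by simp
    then have "\<rho> x = \<rho> y" using xy by (metis inv_inv rc)
    then show "x = y" using rho xy by (auto simp: bij_betw_def inj_on_def)
  qed
  define j where "j i = (\<tau> ^^ i) a" for i
  have j0: "j 0 = a" and jS: "j (Suc i) = \<tau> (j i)" for i by (auto simp: j_def)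
  have jI [simp]: "j i \<in> I" for i by (induction i) (auto simp: j0 jS ac \<tau>I)
  have ex: "\<exists>i. j (Suc i) \<in> {a, c}"
  proof -
    \<comment> \<open>Finiteness of \<open>I\<close> forces \<open>j u = j v\<close> for some
      \<open>u < v\<close>; cancelling \<open>u\<close> applications of the injective
      \<open>\<tau>\<close> gives a return to \<open>a\<close>.\<close>
    have "\<not> inj j" using \<open>finite I\<close> jI by (metis finite_imageD finite_subset image_subsetI infinite_UNIV_nat)
    then obtain u v where uv: "u < v" "j u = j v" by (metis injI linorder_neqE_nat)
    have "j (v - u) = a" using uv
    proof (induction u arbitrary: v)
      case 0 then show ?case by (simp add: j0)
    next
      case (Suc u)
      obtain v' where v': "v = Suc v'" using Suc.prems by (cases v) auto
      have "j u = j v'" using Suc.prems \<tau>inj jI unfolding v' jS by (auto dest: inj_onD)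
      then show ?case using Suc.IH[of v'] Suc.prems v' by simp
    qed
    then show ?thesis using uv by (metis Suc_diff_Suc insertI1)
  qed
  \<comment> \<open>\<open>l\<close> is the last index before the first return, so
    \<open>j 0\<close>, ..., \<open>j l\<close> are distinct and avoid \<open>c\<close>.\<close>
  define l where "l = (LEAST i. j (Suc i) \<in> {a, c})"
  have l: "j (Suc l) \<in> {a, c}" unfolding l_def using ex by (rule LeastI_ex)
  have l_min: "j (Suc i) \<notin> {a, c}" if "i < l" for i
    using not_less_Least that unfolding l_def by blast
  have jinj: "inj_on j {..l}"
  proof (rule linorder_inj_onI)
    fix u v assume "u < v" "u \<in> {..l}" "v \<in> {..l}"
    then show "j u \<noteq> j v"
    proof (induction u arbitrary: v)
      case 0
      then obtain v' where "v = Suc v'" by (cases v) auto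
      then show ?case using l_min[of v'] 0 by (auto simp: j0)
    next
      case (Suc u)
      obtain v' where v': "v = Suc v'" using Suc.prems by (cases v) auto
      have "j u \<noteq> j v'" using Suc.IH[of v'] Suc.prems v' by simp
      then show ?case using \<tau>inj jI unfolding v' jS by (auto dest: inj_onD)
    qed
  qed auto
  have jnc: "j i \<noteq> c" if "i \<le> l" for i
    using that l_min[of "i - 1"] ac by (cases i) (auto simp: j0)
  define P where "P = j ` {..l}"
  define idx where "idx = the_inv_into {..l} j"
  have idx: "idx (j i) = i" if "i \<le> l" for i
    unfolding idx_def using that jinj by (intro the_inv_into_f_f) auto
  define \<rho>' where "\<rho>' x = (if x = c then \<rho> (j l)
      else if x \<in> P then (if idx x = 0 then \<rho> c else \<rho> (j (idx x - 1))) else \<rho> x)" for x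
  have r0: "\<rho>' a = \<rho> c" using ac idx[of 0] by (auto simp: \<rho>'_def P_def j0 intro: image_eqI[of _ _ 0])
  have rS: "\<rho>' (j (Suc i)) = \<rho> (j i)" if "Suc i \<le> l" for i
    using that idx[of "Suc i"] jnc[of "Suc i"] by (auto simp: \<rho>'_def P_def)
  have rc': "\<rho>' c = \<rho> (j l)" by (simp add: \<rho>'_def)
  have ro: "\<rho>' x = \<rho> x" if "x \<notin> P" "x \<noteq> c" for x using that by (simp add: \<rho>'_def)
  have val: "\<rho>' (j i) \<otimes> b (j i) = f (j (Suc i))" if "i \<le> l" for i
  proof (cases i)
    case 0
    have "\<rho> c \<otimes> b a = K \<otimes> inv (\<rho> a)"
      using ac by (simp add: inv_solve_right) (simp add: K_def m_ac)
    then show ?thesis using 0 ac by (simp add: j0 jS r0 f\<tau>)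
  next
    case (Suc i')
    have nac: "j i \<in> I - {a, c}" using l_min[of i'] Suc that by auto
    have "\<rho> (j i) \<otimes> b (j i) = K \<otimes> inv (\<rho> (j i'))"
      using eq[OF nac] f\<tau>[of "j i'"] Suc by (simp add: jS)
    then have "K = \<rho> (j i) \<otimes> b (j i) \<otimes> \<rho> (j i')"
      by (simp add: inv_solve_right)
    then have "K = \<rho> (j i') \<otimes> b (j i) \<otimes> \<rho> (j i)" by (simp add: m_ac)
    then have "K \<otimes> inv (\<rho> (j i)) = \<rho> (j i') \<otimes> b (j i)"
      using inv_solve_right'[of "\<rho> (j i') \<otimes> b (j i)" K "\<rho> (j i)"] by simp
    then show ?thesis using rS[of i'] Suc that f\<tau>[of "j i"] \<tau>I[of "j i'"] by (simp add: jS)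
  qed
  \<comment> \<open>The orbit returns to one of \<open>a\<close> and \<open>c\<close>;
    \<open>e\<close> is the other one. The only value of \<open>f\<close> left for position
    \<open>c\<close> is \<open>f e\<close>, and the product hypothesis makes it occur there.\<close>
  define e where "e = (if j (Suc l) = a then c else a)"
  have e: "{j (Suc l), e} = {a, c}" using l ac by (auto simp: e_def)
  have eI: "e \<in> I" using ac by (auto simp: e_def)
  have valc: "\<rho>' c \<otimes> b c = f e"
  proof -
    have "f (j (Suc l)) \<otimes> f e = f a \<otimes> f c"
      using l ac by (auto simp: e_def m_comm)
    also have "\<dots> = K \<otimes> b c" using prod ac by (simp add: K_def m_ac)
    finally have "K \<otimes> inv (\<rho> (j l)) \<otimes> f e = K \<otimes> b c" by (simp add: jS f\<tau>)
    then have "inv (\<rho> (j l)) \<otimes> f e = b c" using ac eI by (simp add: m_assoc)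
    then show ?thesis using ac eI by (simp add: rc' inv_solve_left')
  qed
  have valo: "\<rho>' x \<otimes> b x = f x" if "x \<in> I" "x \<notin> P" "x \<noteq> c" for x
  proof -
    have "x \<noteq> a" using that by (auto simp: P_def j0[symmetric])
    then show ?thesis using that eq[of x] by (simp add: ro)
  qed
  have im1: "\<rho>' ` I = carrier G"
  proof
    show "\<rho>' ` I \<subseteq> carrier G" using ac by (auto simp: \<rho>'_def)
    have "\<rho> x \<in> \<rho>' ` I" if x: "x \<in> I" for x
    proof -
      consider "x = c" | i where "x = j i" "i < l" | "x = j l" | "x \<notin> P" "x \<noteq> c"
        unfolding P_def by (metis atMost_iff imageE le_neq_implies_less)
      then show ?thesis
      proof cases
        case 1 then show ?thesis using r0 ac by (metis imageI)
      next
        case 2 then show ?thesis using rS[of i] by (metis Suc_leI imageI jI)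
      next
        case 3 then show ?thesis using rc' ac by (metis imageI)
      next
        case 4 then show ?thesis using ro x by (metis imageI)
      qed
    qed
    then show "carrier G \<subseteq> \<rho>' ` I" using rho by (metis bij_betw_imp_surj_on image_subsetI)
  qed
  have im2: "(\<lambda>x. \<rho>' x \<otimes> b x) ` I = carrier G" (is "?g ` I = _")
  proof
    have "x \<in> I \<Longrightarrow> \<rho>' x \<in> carrier G" for x using im1 by blast
    then show "?g ` I \<subseteq> carrier G" by auto
    have "f x \<in> ?g ` I" if x: "x \<in> I" for x
    proof -
      have "x \<in> {j (Suc l), e} \<or> (\<exists>i<l. x = j (Suc i)) \<or> (x \<notin> P \<and> x \<noteq> c)"
      proof (cases "x \<in> P \<or> x = c")
        case True
        then consider i where "x = j i" "i \<le> l" | "x = c" by (auto simp: P_def)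
        then show ?thesis
        proof cases
          case 1
          then show ?thesis
          proof (cases i)
            case 0
            then show ?thesis using e 1 by (auto simp: j0)
          next
            case (Suc i')
            then show ?thesis using 1 Suc_le_lessD by blast
          qed
        qed (use e in auto)
      qed auto
      then consider "x = e" | i where "x = j (Suc i)" "i \<le> l" | "x \<notin> P" "x \<noteq> c"
        using less_imp_le by blast
      then show ?thesis
      proof cases
        case 1
        have "?g c \<in> ?g ` I" using ac by (intro imageI)
        then show ?thesis using valc 1 by simp
      next
        case 2
        have "?g (j i) \<in> ?g ` I" by (intro imageI) simp
        then show ?thesis using val[of i] 2 by simp
      next
        case 3
        have "?g x \<in> ?g ` I" using x by (intro imageI)
        then show ?thesis using valo[OF x] 3 by simp
      qed
    qed
    then show "carrier G \<subseteq> ?g ` I" using f by (metis bij_betw_imp_surj_on image_subsetI)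
  qed
  have "inj_on \<rho>' I" "inj_on ?g I"
    using im1 im2 card_I \<open>finite I\<close> by (metis eq_card_imp_inj_on)+
  then show ?thesis using im1 im2 by (auto simp: bij_betw_def)
qed

text \<open>Induction on the number of nontrivial values of \<open>b\<close>. Merging two of them
  into one position gives a family with fewer nontrivial values and the same product; a solution for
  it is wrong for \<open>b\<close> at two positions only, which is what \<open>hall_exchange\<close>
  repairs.\<close>

theorem (in comm_group) hall_rearrangement:
  assumes fin: "finite (carrier G)" and "finite I" "card I = order G"
    and "b \<in> I \<rightarrow> carrier G" and "(\<Otimes>x\<in>I. b x) = \<one>"
  shows "\<exists>\<rho>. bij_betw \<rho> I (carrier G) \<and> bij_betw (\<lambda>x. \<rho> x \<otimes> b x) I (carrier G)"
  using assms(4,5)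
proof (induction "card {x\<in>I. b x \<noteq> \<one>}" arbitrary: b rule: less_induct)
  case less
  note bI = less.prems(1)
  have bc [simp]: "x \<in> I \<Longrightarrow> b x \<in> carrier G" for x using bI by auto
  show ?case
  proof (cases "\<forall>x\<in>I. b x = \<one>")
    case True
    obtain \<rho> where r: "bij_betw \<rho> I (carrier G)"
      using assms by (metis finite_same_card_bij order_def)
    then have "bij_betw (\<lambda>x. \<rho> x \<otimes> b x) I (carrier G)"
      using True by (subst bij_betw_cong[of I _ \<rho>]) (auto simp: bij_betw_def intro!: r_one)
    then show ?thesis using r by blast
  next
    case False
    then obtain a where a: "a \<in> I" "b a \<noteq> \<one>" by auto
    \<comment> \<open>A product equal to \<open>\<one>\<close> cannot have exactly one nontrivial
      factor.\<close>
    have "\<exists>c\<in>I - {a}. b c \<noteq> \<one>"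
    proof (rule ccontr)
      assume "\<not> ?thesis"
      then have "(\<Otimes>x\<in>I - {a}. b x) = \<one>" by (intro finprod_one_eqI) auto
      moreover have "(\<Otimes>x\<in>I. b x) = b a \<otimes> (\<Otimes>x\<in>I - {a}. b x)"
        using a bI \<open>finite I\<close> finprod_insert[of "I - {a}" a b] by (auto simp: insert_absorb Pi_iff)
      ultimately show False using a less.prems by (auto simp: Pi_iff)
    qed
    then obtain c where c: "c \<in> I" "c \<noteq> a" "b c \<noteq> \<one>" by auto
    \<comment> \<open>Position \<open>c\<close> becomes trivial and \<open>a\<close> was nontrivial
      already, so the induction measure drops.\<close>
    define b' where "b' = b(a := b a \<otimes> b c, c := \<one>)"
    have b'I: "b' \<in> I \<rightarrow> carrier G" using bI a c by (auto simp: b'_def)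
    have split: "(\<Otimes>x\<in>I. h x) = h a \<otimes> h c \<otimes> (\<Otimes>x\<in>I - {a, c}. h x)"
      if h: "h \<in> I \<rightarrow> carrier G" for h
    proof -
      have "I = insert a (insert c (I - {a, c}))" using a c by auto
      then have "(\<Otimes>x\<in>I. h x) = (\<Otimes>x\<in>insert a (insert c (I - {a, c})). h x)" by simp
      also have "\<dots> = h a \<otimes> (h c \<otimes> (\<Otimes>x\<in>I - {a, c}. h x))"
        using \<open>finite I\<close> a c h by (subst finprod_insert; simp add: Pi_iff)+
      also have "\<dots> = h a \<otimes> h c \<otimes> (\<Otimes>x\<in>I - {a, c}. h x)"
        using a c h by (intro m_assoc[symmetric] finprod_closed) (auto simp: Pi_iff)
      finally show ?thesis .
    qed
    have "(\<Otimes>x\<in>I. b' x) = (\<Otimes>x\<in>I. b x)"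
    proof -
      have "(\<Otimes>x\<in>I - {a, c}. b' x) = (\<Otimes>x\<in>I - {a, c}. b x)"
        using bI by (intro finprod_cong') (auto simp: b'_def)
      then show ?thesis using split[OF bI] split[OF b'I] bI a c by (simp add: b'_def Pi_iff)
    qed
    moreover have "card {x\<in>I. b' x \<noteq> \<one>} < card {x\<in>I. b x \<noteq> \<one>}"
      using \<open>finite I\<close> a c by (intro psubset_card_mono) (auto simp: b'_def split: if_splits)
    ultimately obtain \<rho> where \<rho>: "bij_betw \<rho> I (carrier G)"
      and f: "bij_betw (\<lambda>x. \<rho> x \<otimes> b' x) I (carrier G)"
      using less.hyps[of b'] b'I less.prems by auto
    show ?thesis
    proof (rule hall_exchange[OF comm_group_axioms fin \<open>finite I\<close> bI \<rho> f a(1) c(1)])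
      show "\<rho> a \<otimes> b' a \<otimes> (\<rho> c \<otimes> b' c) = \<rho> a \<otimes> \<rho> c \<otimes> (b a \<otimes> b c)"
      proof -
        have [simp]: "\<rho> a \<in> carrier G" "\<rho> c \<in> carrier G" using \<rho> a c by (auto simp: bij_betw_def)
        show ?thesis using a c by (simp add: b'_def m_ac)
      qed
    qed (use c in \<open>auto simp: b'_def\<close>)
  qed
qed

section \<open>Counting pairs of rearrangements\<close>

text \<open>Fix a point \<open>a\<close>. Deleting it from an odd subset is invertible, since the
  parity of what remains tells whether \<open>a\<close> was there.\<close>

lemma card_odd_subsets:
  assumes "finite S" "S \<noteq> {}"
  shows "2 * card {B. B \<subseteq> S \<and> odd (card B)} = 2 ^ card S"
proof -
  obtain a T where S: "S = insert a T" "a \<notin> T" "finite T"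
    using assms by (metis Set.set_insert ex_in_conv finite_insert)
  have "bij_betw (\<lambda>B. B - {a}) {B. B \<subseteq> S \<and> odd (card B)} (Pow T)"
  proof (rule bij_betwI[where g = "\<lambda>B. if odd (card B) then B else insert a B"])
    show "(\<lambda>B. B - {a}) \<in> {B. B \<subseteq> S \<and> odd (card B)} \<rightarrow> Pow T" using S by auto
    show "(\<lambda>B. if odd (card B) then B else insert a B) \<in> Pow T \<rightarrow> {B. B \<subseteq> S \<and> odd (card B)}"
    proof
      fix B assume B: "B \<in> Pow T"
      then have "finite B" "a \<notin> B" using S finite_subset by auto
      then show "(if odd (card B) then B else insert a B) \<in> {B. B \<subseteq> S \<and> odd (card B)}"
        using S B by auto
    qed
    show "(if odd (card (B - {a})) then B - {a} else insert a (B - {a})) = B"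
      if "B \<in> {B. B \<subseteq> S \<and> odd (card B)}" for B
    proof (cases "a \<in> B")
      case True
      have "finite B" using that assms finite_subset by blast
      then have "card B = Suc (card (B - {a}))" using True by (metis card.remove)
      then show ?thesis using that True by auto
    qed (use that in auto)
    show "(if odd (card B) then B else insert a B) - {a} = B" if "B \<in> Pow T" for B
      using that S by auto
  qed
  then have "card {B. B \<subseteq> S \<and> odd (card B)} = 2 ^ card T"
    using S by (simp add: bij_betw_same_card card_Pow)
  then show ?thesis using S by simp
qed

text \<open>Cauchy-Schwarz for the fibre sizes: they sum to \<open>card X\<close>, and their squares
  sum to the number of colliding pairs.\<close>

lemma card_collisions_ge:
  assumes "finite X" "finite Y" "f ` X \<subseteq> Y"
  shows "(card X)\<^sup>2 \<le> card Y * card {(a, b). a \<in> X \<and> b \<in> X \<and> f a = f b}"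
proof -
  define F where "F y = {x \<in> X. f x = y}" for y
  have fin: "finite (F y)" for y using assms by (simp add: F_def)
  have X: "card X = (\<Sum>y\<in>Y. card (F y))"
    using assms sum_fun_comp[of X Y f "\<lambda>_. 1::nat"] by (simp add: F_def)
  have "{(a, b). a \<in> X \<and> b \<in> X \<and> f a = f b} = (\<Union>y\<in>Y. F y \<times> F y)"
    using assms by (auto simp: F_def)
  also have "card \<dots> = (\<Sum>y\<in>Y. card (F y \<times> F y))"
    using assms(2) fin by (intro card_UN_disjoint) (auto simp: F_def)
  also have "\<dots> = (\<Sum>y\<in>Y. (card (F y))\<^sup>2)" by (simp add: card_cartesian_product power2_eq_square)
  finally have C: "card {(a, b). a \<in> X \<and> b \<in> X \<and> f a = f b} = (\<Sum>y\<in>Y. (card (F y))\<^sup>2)" .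
  have "(real (card X))\<^sup>2 \<le> (\<Sum>y\<in>Y. (real (card (F y)))\<^sup>2) * card Y"
    unfolding X of_nat_sum by (rule sum_squared_le_sum_of_squares)
  then have "real ((card X)\<^sup>2) \<le> real (card Y * card {(a, b). a \<in> X \<and> b \<in> X \<and> f a = f b})"
    by (simp add: C mult.commute)
  then show ?thesis by (simp only: of_nat_le_iff)
qed

text \<open>Inversion permutes the group, so the product of all elements equals its own
  inverse.\<close>

lemma (in comm_group) finprod_carrier_square:
  "(\<Otimes>x\<in>carrier G. x) \<otimes> (\<Otimes>x\<in>carrier G. x) = \<one>"
proof -
  have "bij_betw (\<lambda>x. inv x) (carrier G) (carrier G)"
    by (rule bij_betwI[where g = "\<lambda>x. inv x"]) auto
  then have bij: "(\<lambda>x. inv x) ` carrier G = carrier G" "inj_on (\<lambda>x. inv x) (carrier G)"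
    by (auto simp: bij_betw_def)
  have "(\<Otimes>x\<in>carrier G. x) = (\<Otimes>x\<in>carrier G. inv x)"
    using finprod_reindex[of "\<lambda>x. x" "\<lambda>x. inv x" "carrier G"] bij by simp
  then have "(\<Otimes>x\<in>carrier G. x) \<otimes> (\<Otimes>x\<in>carrier G. x)
      = (\<Otimes>x\<in>carrier G. x) \<otimes> (\<Otimes>x\<in>carrier G. inv x)" by simp
  also have "\<dots> = (\<Otimes>x\<in>carrier G. x \<otimes> inv x)"
    by (intro finprod_multf[symmetric]) auto
  also have "\<dots> = \<one>" by (intro finprod_one_eqI) auto
  finally show ?thesis .
qed

text \<open>
  The sizes \<open>k\<close> are restricted to \<open>P [^] k = P\<close>, where \<open>P\<close> will be the product of all group elements,
  because translating a \<open>k\<close>-subset by \<open>P\<close> then multiplies its product by exactly \<open>P\<close>.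
\<close>
lemma (in comm_group) card_subsets_fixing_involution:
  assumes fin: "finite (carrier G)" and P: "P \<in> carrier G" "P \<otimes> P = \<one>"
    and K: "K = {k. k \<le> order G \<and> P [^] k = P}"
  shows "4 ^ order G * card K \<le> 2 * order G * (card {B. B \<subseteq> carrier G \<and> card B \<in> K})\<^sup>2"
proof (cases "P = \<one>")
  case True
  \<comment> \<open>All sizes and all subsets qualify, and
    \<open>order G + 1 \<le> 2 * order G\<close> suffices.\<close>
  then have "K = {..order G}" using K by auto
  moreover from this have "{B. B \<subseteq> carrier G \<and> card B \<in> K} = Pow (carrier G)"
    using fin by (auto simp: order_def card_mono)
  moreover have "order G > 0" using fin by (simp add: order_gt_0_iff_finite)
  moreover have "(2 ^ order G)\<^sup>2 = (4::nat) ^ order G"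
    by (simp add: power2_eq_square flip: power_mult_distrib)
  ultimately show ?thesis using fin by (simp add: card_Pow flip: order_def)
next
  case False
  \<comment> \<open>Now \<open>P\<close> has order two, so \<open>order G\<close> is an even number
    \<open>2 * h\<close>. The admissible sizes are the \<open>h\<close> odd ones, and half of all
    subsets qualify, which gives equality.\<close>
  have pow: "P [^] k = (if even k then \<one> else P)" for k :: nat
    using P by (induction k) auto
  have ev: "even (order G)"
  proof (rule ccontr)
    assume "odd (order G)"
    then show False using pow_order_eq_1[of P] pow[of "order G"] P False by simp
  qed
  then obtain h where h: "order G = 2 * h" by auto
  have Kodd: "K = {k. k \<le> order G \<and> odd k}" using K pow False by auto
  have "K = (\<lambda>i. 2 * i + 1) ` {..<h}"
    unfolding Kodd h by (auto simp: image_iff elim!: oddE)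
  then have cK: "card K = h" by (simp add: card_image inj_on_def)
  have "{B. B \<subseteq> carrier G \<and> card B \<in> K} = {B. B \<subseteq> carrier G \<and> odd (card B)}"
    using Kodd fin by (auto simp: order_def card_mono)
  then have "2 * card {B. B \<subseteq> carrier G \<and> card B \<in> K} = 2 ^ order G"
    using card_odd_subsets[OF fin] P by (auto simp: order_def)
  then have "(2 * card {B. B \<subseteq> carrier G \<and> card B \<in> K})\<^sup>2 = 4 ^ order G"
    by (simp add: power2_eq_square flip: power_mult_distrib)
  then show ?thesis using cK h by (simp add: power2_eq_square)
qed

text \<open>Each pair \<open>B\<close>, \<open>C\<close> of subsets with equal size and equal
  product yields a balanced \<open>A\<close>: \<open>B\<close> is read in \<open>E1\<close>, and
  \<open>C\<close>, translated and complemented, in \<open>E2\<close>. The collision bound supplies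
  enough pairs, since (size, product) takes at most \<open>card K * order G\<close> values.\<close>

lemma (in comm_group) card_balanced_subsets_ge:
  assumes fin: "finite (carrier G)" and disj: "E1 \<inter> E2 = {}"
    and b1: "bij_betw \<pi> E1 (carrier G)" and b2: "bij_betw \<pi> E2 (carrier G)"
  shows "4 ^ order G \<le> 2 * (order G)\<^sup>2 *
    card {A. A \<subseteq> E1 \<union> E2 \<and> card A = order G \<and> finprod G \<pi> A = \<one> \<and> finprod G \<pi> (E1 \<union> E2 - A) = \<one>}"
    (is "_ \<le> _ * card ?\<A>")
proof -
  define P where "P = (\<Otimes>x\<in>carrier G. x)"
  have P [simp]: "P \<in> carrier G" by (simp add: P_def)
  have PP: "P \<otimes> P = \<one>" by (simp add: P_def finprod_carrier_square)
  have PPx: "P \<otimes> (P \<otimes> x) = x" if "x \<in> carrier G" for x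
    using that PP by (simp flip: m_assoc)
  have finE: "finite E1" "finite E2" using b1 b2 fin by (auto simp: bij_betw_finite)
  have [simp]: "e \<in> E1 \<Longrightarrow> \<pi> e \<in> carrier G" "e \<in> E2 \<Longrightarrow> \<pi> e \<in> carrier G" for e
    using b1 b2 by (auto simp: bij_betw_def)
  have idP: "(\<lambda>x. x) \<in> V \<rightarrow> carrier G" if "V \<subseteq> carrier G" for V using that by auto
  have prodc: "(\<Otimes>x\<in>V. x) \<in> carrier G" if "V \<subseteq> carrier G" for V
    using idP[OF that] by (rule finprod_closed)
  define K where "K = {k. k \<le> order G \<and> P [^] k = P}"
  define X where "X = {B. B \<subseteq> carrier G \<and> card B \<in> K}"
  define f where "f B = (card B, \<Otimes>x\<in>B. x)" for B
  define Q where "Q = {(B, C). B \<in> X \<and> C \<in> X \<and> f B = f C}"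
  \<comment> \<open>The part in \<open>E2\<close> is the complement of \<open>P C\<close>, whose product is inverse to that of \<open>C\<close>.\<close>
  define A where "A = (\<lambda>(B, C). {e\<in>E1. \<pi> e \<in> B} \<union> {e\<in>E2. P \<otimes> \<pi> e \<notin> C})"
  have finX: "finite X" using fin by (simp add: X_def)
  have finK: "finite K" by (simp add: K_def)
  have "f ` X \<subseteq> K \<times> carrier G" by (auto simp: f_def X_def intro!: finprod_closed)
  then have "(card X)\<^sup>2 \<le> card (K \<times> carrier G) * card Q"
    unfolding Q_def using finX finK fin by (intro card_collisions_ge) auto
  then have cX: "(card X)\<^sup>2 \<le> card K * order G * card Q"
    by (simp add: card_cartesian_product order_def)
  have "4 ^ order G * card K \<le> 2 * order G * (card X)\<^sup>2"
    unfolding X_def using card_subsets_fixing_involution[OF fin P PP K_def] .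
  also have "\<dots> \<le> 2 * order G * (card K * order G * card Q)"
    using cX by (intro mult_left_mono) auto
  finally have "4 ^ order G * card K \<le> (2 * (order G)\<^sup>2 * card Q) * card K"
    by (simp add: power2_eq_square mult_ac)
  \<comment> \<open>The size \<open>1\<close> always lies in \<open>K\<close>, so the factor
    \<open>card K\<close> can be cancelled.\<close>
  moreover have "card K > 0"
  proof -
    have "order G > 0" using fin by (simp add: order_gt_0_iff_finite)
    then have "1 \<in> K" by (simp add: K_def)
    then show ?thesis using finK by (auto simp: card_gt_0_iff)
  qed
  ultimately have main: "4 ^ order G \<le> 2 * (order G)\<^sup>2 * card Q" by simp
  have "card Q \<le> card ?\<A>"
  proof (rule card_inj_on_le)
    show "inj_on A Q"
    proof (rule inj_onI)
      fix z z' assume "z \<in> Q" "z' \<in> Q" "A z = A z'"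
      then obtain B C B' C' where z: "z = (B, C)" "z' = (B', C')"
        and q: "(B, C) \<in> Q" "(B', C') \<in> Q" "A (B, C) = A (B', C')" by (metis surj_pair)
      then have sub: "B \<subseteq> carrier G" "C \<subseteq> carrier G" "B' \<subseteq> carrier G" "C' \<subseteq> carrier G"
        by (auto simp: Q_def X_def)
      have "A (B, C) \<inter> E1 = {e\<in>E1. \<pi> e \<in> B}" "A (B', C') \<inter> E1 = {e\<in>E1. \<pi> e \<in> B'}"
        using disj by (auto simp: A_def)
      then have e1: "\<pi> e \<in> B \<longleftrightarrow> \<pi> e \<in> B'" if "e \<in> E1" for e using q that by auto
      have "A (B, C) \<inter> E2 = {e\<in>E2. P \<otimes> \<pi> e \<notin> C}" "A (B', C') \<inter> E2 = {e\<in>E2. P \<otimes> \<pi> e \<notin> C'}"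
        using disj by (auto simp: A_def)
      then have e2: "P \<otimes> \<pi> e \<in> C \<longleftrightarrow> P \<otimes> \<pi> e \<in> C'" if "e \<in> E2" for e using q that by auto
      have "x \<in> B \<longleftrightarrow> x \<in> B'" if "x \<in> carrier G" for x
      proof -
        have "x \<in> \<pi> ` E1" using that b1 by (simp add: bij_betw_def)
        then show ?thesis using e1 by force
      qed
      moreover have "x \<in> C \<longleftrightarrow> x \<in> C'" if "x \<in> carrier G" for x
      proof -
        have "P \<otimes> x \<in> \<pi> ` E2" using that b2 by (simp add: bij_betw_def)
        then obtain e where "e \<in> E2" "\<pi> e = P \<otimes> x" by force
        then show ?thesis using e2[of e] PPx that by simp
      qed
      ultimately show "z = z'" using sub unfolding z by blast
    qed
    show "A ` Q \<subseteq> ?\<A>"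
    proof (rule image_subsetI)
      fix z assume "z \<in> Q"
      then obtain B C where z: "z = (B, C)" and q: "(B, C) \<in> Q" by (metis surj_pair)
      then have sub: "B \<subseteq> carrier G" "C \<subseteq> carrier G" and card: "card B = card C"
        and prod: "(\<Otimes>x\<in>B. x) = (\<Otimes>x\<in>C. x)" and CK: "card C \<in> K"
        by (auto simp: Q_def X_def f_def)
      have fs: "finite B" "finite C" using sub fin finite_subset by blast+
      define A1 where "A1 = {e\<in>E1. \<pi> e \<in> B}"
      define A2 where "A2 = {e\<in>E2. P \<otimes> \<pi> e \<notin> C}"
      define D where "D = {x\<in>carrier G. P \<otimes> x \<notin> C}"
      have D': "{x\<in>carrier G. P \<otimes> x \<in> C} = (\<lambda>x. P \<otimes> x) ` C"
      proof (intro equalityI subsetI)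
        fix x assume "x \<in> {x\<in>carrier G. P \<otimes> x \<in> C}"
        then show "x \<in> (\<lambda>x. P \<otimes> x) ` C" using PPx[of x] by (metis imageI mem_Collect_eq)
      next
        fix x assume "x \<in> (\<lambda>x. P \<otimes> x) ` C"
        then show "x \<in> {x\<in>carrier G. P \<otimes> x \<in> C}" using sub PPx by auto
      qed
      have injP: "inj_on (\<lambda>x. P \<otimes> x) C" using sub PPx by (metis inj_onI subsetD)
      have cG: "carrier G = (\<lambda>x. P \<otimes> x) ` C \<union> D" "(\<lambda>x. P \<otimes> x) ` C \<inter> D = {}"
        using D' by (auto simp: D_def)
      have finD: "finite D" using fin by (simp add: D_def)
      have i1: "bij_betw \<pi> A1 B" using b1 sub unfolding A1_def bij_betw_def inj_on_def by auto
      have i2: "bij_betw \<pi> A2 D" using b2 unfolding A2_def D_def bij_betw_def inj_on_def by auto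
      have prod_bij: "finprod G \<pi> U = (\<Otimes>x\<in>V. x)" if "bij_betw \<pi> U V" "V \<subseteq> carrier G" for U V
      proof -
        have "(\<Otimes>x\<in>\<pi> ` U. x) = finprod G (\<lambda>e. \<pi> e) U"
          using that by (intro finprod_reindex) (auto simp: bij_betw_def)
        then show ?thesis using that by (simp add: bij_betw_def)
      qed
      have fA: "finite A1" "finite A2" "A1 \<inter> A2 = {}" using finE disj by (auto simp: A1_def A2_def)
      have AU: "A (B, C) = A1 \<union> A2" by (simp add: A_def A1_def A2_def)
      have cc: "order G = card C + card D"
        unfolding order_def by (subst cG(1), subst card_Un_disjoint) (use cG fs finD injP card_image in auto)
      have "card (A (B, C)) = card B + card D"
        unfolding AU using fA i1 i2 by (simp add: card_Un_disjoint bij_betw_same_card)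
      then have cA: "card (A (B, C)) = order G" using cc card by simp
      have Pc: "P [^] card C = P" using CK by (simp add: K_def)
      have sD: "D \<subseteq> carrier G" "(\<lambda>x. P \<otimes> x) ` C \<subseteq> carrier G" using sub by (auto simp: D_def)
      \<comment> \<open>The product \<open>P\<close> of all elements is split along the translate of
        \<open>C\<close> and its complement \<open>D\<close>. The translation contributes
        \<open>P [^] card C = P\<close>, which cancels and leaves \<open>D\<close> with the product
        inverse to that of \<open>C\<close>.\<close>
      have "P = (\<Otimes>x\<in>(\<lambda>x. P \<otimes> x) ` C \<union> D. x)" 
        using arg_cong[OF cG(1), of "\<lambda>V. \<Otimes>x\<in>V. x"] by (simp flip: P_def)
      also have "\<dots> = (\<Otimes>x\<in>(\<lambda>x. P \<otimes> x) ` C. x) \<otimes> (\<Otimes>x\<in>D. x)"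
        using cG(2) fs finD sD idP by (intro finprod_Un_disjoint) auto
      also have "(\<Otimes>x\<in>(\<lambda>x. P \<otimes> x) ` C. x) = (\<Otimes>x\<in>C. P \<otimes> x)"
        using sD idP injP by (intro finprod_reindex) auto
      also have "\<dots> = (\<Otimes>x\<in>C. P) \<otimes> (\<Otimes>x\<in>C. x)"
        using sub by (intro finprod_multf) auto
      also have "\<dots> = P \<otimes> (\<Otimes>x\<in>C. x)" using Pc by (simp add: finprod_const)
      finally have "P \<otimes> ((\<Otimes>x\<in>C. x) \<otimes> (\<Otimes>x\<in>D. x)) = P \<otimes> \<one>"
        using sub sD prodc by (simp add: m_assoc)
      then have "(\<Otimes>x\<in>C. x) \<otimes> (\<Otimes>x\<in>D. x) = \<one>"
        using sub sD prodc by (subst (asm) Units_l_cancel) auto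
      moreover have "finprod G \<pi> (A (B, C)) = (\<Otimes>x\<in>B. x) \<otimes> (\<Otimes>x\<in>D. x)"
        unfolding AU using fA sub prod_bij[OF i1] prod_bij[OF i2]
        by (subst finprod_Un_disjoint) (auto simp: A1_def A2_def D_def)
      ultimately have pA: "finprod G \<pi> (A (B, C)) = \<one>" using prod by simp
      have sA: "A (B, C) \<subseteq> E1 \<union> E2" by (auto simp: A_def)
      \<comment> \<open>The total product is \<open>P \<otimes> P = \<one>\<close>, so the
        complement of \<open>A\<close> is balanced as soon as \<open>A\<close> is.\<close>
      have "finprod G \<pi> (E1 \<union> E2) = P \<otimes> P"
        using finE disj prod_bij[OF b1] prod_bij[OF b2]
        by (subst finprod_Un_disjoint) (auto simp: P_def)
      moreover have "finprod G \<pi> (E1 \<union> E2)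
          = finprod G \<pi> (A (B, C)) \<otimes> finprod G \<pi> (E1 \<union> E2 - A (B, C))"
        using finE sA finite_subset[OF sA]
        by (subst finprod_Un_disjoint[symmetric]) (auto simp: Un_absorb1)
      moreover have "finprod G \<pi> (E1 \<union> E2 - A (B, C)) \<in> carrier G"
        by (intro finprod_closed) auto
      ultimately have "finprod G \<pi> (E1 \<union> E2 - A (B, C)) = \<one>"
        using pA PP by simp
      then show "A z \<in> ?\<A>" using sA cA pA by (simp add: z)
    qed
    show "finite ?\<A>" using finE by (auto intro: finite_subset[of _ "Pow (E1 \<union> E2)"])
  qed
  then have "2 * (order G)\<^sup>2 * card Q \<le> 2 * (order G)\<^sup>2 * card ?\<A>" by (intro mult_left_mono) auto
  then show ?thesis using main by linarith
qed

text \<open>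
  Left translations of the two solutions given by Hall's theorem contribute the factor
  \<open>(order G)\<^sup>2\<close>, which cancels the loss in the choice of a balanced subset.
\<close>
theorem (in comm_group) card_double_rearrangements_ge:
  fixes \<pi> :: "'e \<Rightarrow> 'a"
  assumes fin: "finite (carrier G)" and disj: "E1 \<inter> E2 = {}"
    and b1: "bij_betw \<pi> E1 (carrier G)" and b2: "bij_betw \<pi> E2 (carrier G)"
  shows "4 ^ order G \<le> 2 * card {r \<in> (E1 \<union> E2) \<rightarrow>\<^sub>E ((UNIV :: bool set) \<times> carrier G).
      bij_betw r (E1 \<union> E2) (UNIV \<times> carrier G) \<and>
      bij_betw (\<lambda>e. (fst (r e), snd (r e) \<otimes> \<pi> e)) (E1 \<union> E2) (UNIV \<times> carrier G)}"
    (is "_ \<le> _ * card ?R")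
proof -
  define E where "E = E1 \<union> E2"
  have finE: "finite E1" "finite E2" using b1 b2 fin by (auto simp: bij_betw_finite)
  have cE: "card E = 2 * order G"
    using finE disj b1 b2 by (simp add: E_def card_Un_disjoint bij_betw_same_card order_def)
  have fE: "finite E" using finE by (simp add: E_def)
  have piE: "e \<in> E \<Longrightarrow> \<pi> e \<in> carrier G" for e using b1 b2 by (auto simp: E_def bij_betw_def)
  define \<A> where "\<A> = {A. A \<subseteq> E \<and> card A = order G \<and> finprod G \<pi> A = \<one> \<and> finprod G \<pi> (E - A) = \<one>}"
  have "\<exists>\<rho>. bij_betw \<rho> A (carrier G) \<and> bij_betw (\<lambda>x. \<rho> x \<otimes> \<pi> x) A (carrier G)"
    if "A \<subseteq> E" "card A = order G" "finprod G \<pi> A = \<one>" for A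
    using that fE piE by (intro hall_rearrangement[OF fin]) (auto dest: finite_subset)
  then obtain \<rho> where \<rho>: "\<And>A. A \<subseteq> E \<Longrightarrow> card A = order G \<Longrightarrow> finprod G \<pi> A = \<one> \<Longrightarrow>
      bij_betw (\<rho> A) A (carrier G) \<and> bij_betw (\<lambda>x. \<rho> A x \<otimes> \<pi> x) A (carrier G)"
    by metis
  have shift: "bij_betw (\<lambda>x. h \<otimes> k x) A (carrier G)"
    if "h \<in> carrier G" "bij_betw k A (carrier G)" for h k and A :: "'e set"
  proof -
    have "bij_betw (\<lambda>x. h \<otimes> x) (carrier G) (carrier G)"
      using that(1) by (simp add: bij_betw_def inj_on_cmult surj_const_mult)
    from bij_betw_trans[OF that(2) this] show ?thesis by (simp add: comp_def)
  qed
  \<comment> \<open>\<open>A\<close> is served by the copy \<open>False\<close> of the group and its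
    complement by the copy \<open>True\<close>; \<open>h\<close> and \<open>h'\<close> translate the
    two Hall solutions independently.\<close>
  define F where "F = (\<lambda>(A, h, h'). \<lambda>e\<in>E.
      if e \<in> A then (False, h \<otimes> \<rho> A e) else (True, h' \<otimes> \<rho> (E - A) e))"
  have glue: "bij_betw (\<lambda>e. if e \<in> A then (False, k e) else (True, k' e)) E (UNIV \<times> carrier G)"
    if "A \<subseteq> E" "bij_betw k A (carrier G)" "bij_betw k' (E - A) (carrier G)" for A k k'
  proof -
    have 1: "bij_betw (\<lambda>e. if e \<in> A then (False, k e) else (True, k' e)) A ({False} \<times> carrier G)"
      using that(2) unfolding bij_betw_def inj_on_def by auto
    have 2: "bij_betw (\<lambda>e. if e \<in> A then (False, k e) else (True, k' e)) (E - A) ({True} \<times> carrier G)"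
      using that(3) unfolding bij_betw_def inj_on_def by auto
    have "bij_betw (\<lambda>e. if e \<in> A then (False, k e) else (True, k' e)) (A \<union> (E - A))
        ({False} \<times> carrier G \<union> {True} \<times> carrier G)"
      by (rule bij_betw_combine[OF 1 2]) auto
    moreover have "A \<union> (E - A) = E" "{False} \<times> carrier G \<union> {True} \<times> carrier G = UNIV \<times> carrier G"
      using that(1) by (auto simp: UNIV_bool)
    ultimately show ?thesis by simp
  qed
  have "card (\<A> \<times> carrier G \<times> carrier G) \<le> card ?R"
  proof (rule card_inj_on_le)
    show "inj_on F (\<A> \<times> carrier G \<times> carrier G)"
    proof (rule inj_onI)
      fix z z' assume "z \<in> \<A> \<times> carrier G \<times> carrier G" "z' \<in> \<A> \<times> carrier G \<times> carrier G" "F z = F z'"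
      then obtain A g g' B h h' where z: "z = (A, g, g')" "z' = (B, h, h')"
        and A: "A \<in> \<A>" "B \<in> \<A>" and g: "g \<in> carrier G" "g' \<in> carrier G" "h \<in> carrier G" "h' \<in> carrier G"
        and eq: "F (A, g, g') = F (B, h, h')" by auto
      have sub: "A \<subseteq> E" "B \<subseteq> E" using A by (auto simp: \<A>_def)
      \<comment> \<open>The first components recover \<open>A\<close>; one point in each half then
        recovers the translations.\<close>
      have fib: "{e\<in>E. \<not> fst (F (C, u, v) e)} = C" if "C \<subseteq> E" for C u v
        using that by (auto simp: F_def)
      have AB: "A = B" using fib[OF sub(1)] fib[OF sub(2)] eq by metis
      have cA: "card A = order G" "card (E - A) = order G"
        using A sub cE fE by (auto simp: \<A>_def card_Diff_subset finite_subset)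
      have "order G > 0" using fin by (simp add: order_gt_0_iff_finite)
      then obtain e e' where e: "e \<in> A" "e' \<in> E - A"
        using cA by (metis card.empty ex_in_conv less_irrefl)
      have rA: "\<rho> A e \<in> carrier G" "\<rho> (E - A) e' \<in> carrier G"
        using \<rho>[of A] \<rho>[of "E - A"] A cA e by (auto simp: \<A>_def bij_betw_def)
      have "F (A, g, g') e = F (A, h, h') e" "F (A, g, g') e' = F (A, h, h') e'"
        using eq AB by simp_all
      then show "z = z'" using AB e sub g rA by (auto simp: F_def z)
    qed
    show "F ` (\<A> \<times> carrier G \<times> carrier G) \<subseteq> ?R"
    proof (rule image_subsetI)
      fix z assume "z \<in> \<A> \<times> carrier G \<times> carrier G"
      then obtain A h h' where z: "z = (A, h, h')" and A: "A \<in> \<A>"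
        and h: "h \<in> carrier G" "h' \<in> carrier G" by auto
      let ?r = "F (A, h, h')"
      have sub: "A \<subseteq> E" using A by (auto simp: \<A>_def)
      have cA: "card A = order G" "card (E - A) = order G"
        using A sub cE fE by (auto simp: \<A>_def card_Diff_subset finite_subset)
      have 1: "bij_betw (\<rho> A) A (carrier G)" "bij_betw (\<lambda>x. \<rho> A x \<otimes> \<pi> x) A (carrier G)"
        using \<rho>[of A] A cA by (auto simp: \<A>_def)
      have 2: "bij_betw (\<rho> (E - A)) (E - A) (carrier G)"
          "bij_betw (\<lambda>x. \<rho> (E - A) x \<otimes> \<pi> x) (E - A) (carrier G)"
        using \<rho>[of "E - A"] A cA by (auto simp: \<A>_def)
      have r1: "bij_betw ?r E (UNIV \<times> carrier G)"
        using glue[OF sub shift[OF h(1) 1(1)] shift[OF h(2) 2(1)]]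
        by (rule bij_betw_cong[THEN iffD1, rotated]) (auto simp: F_def)
      have r2: "bij_betw (\<lambda>e. (fst (?r e), snd (?r e) \<otimes> \<pi> e)) E (UNIV \<times> carrier G)"
      proof (rule bij_betw_cong[THEN iffD1, OF _ glue[OF sub shift[OF h(1) 1(2)] shift[OF h(2) 2(2)]]])
        fix e assume "e \<in> E"
        moreover have "e \<in> A \<Longrightarrow> \<rho> A e \<in> carrier G" "e \<in> E - A \<Longrightarrow> \<rho> (E - A) e \<in> carrier G"
          using 1 2 by (auto simp: bij_betw_def)
        ultimately show "(if e \<in> A then (False, h \<otimes> (\<rho> A e \<otimes> \<pi> e)) else (True, h' \<otimes> (\<rho> (E - A) e \<otimes> \<pi> e)))
            = (fst (?r e), snd (?r e) \<otimes> \<pi> e)"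
          using h piE by (auto simp: F_def m_assoc)
      qed
      have "?r \<in> E \<rightarrow>\<^sub>E (UNIV \<times> carrier G)"
        using r1 by (auto simp: bij_betw_def PiE_def F_def Pi_iff)
      then show "F z \<in> ?R" using r1 r2 by (simp add: E_def z)
    qed
    show "finite ?R"
      using finE fin by (intro finite_subset[of ?R "(E1 \<union> E2) \<rightarrow>\<^sub>E (UNIV \<times> carrier G)"] finite_PiE) auto
  qed
  moreover have "4 ^ order G \<le> 2 * (order G)\<^sup>2 * card \<A>"
    unfolding \<A>_def E_def using card_balanced_subsets_ge[OF fin disj b1 b2] .
  ultimately show ?thesis
    by (simp add: card_cartesian_product order_def power2_eq_square mult_ac)
qed

section \<open>Assigning exponents to residues modulo a squarefree number\<close>

text \<open>Units are represented by their least residues. The identity is \<open>1 mod d\<close>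
  because for \<open>d = 1\<close> the only element is \<open>0\<close>.\<close>

definition unit_group :: "nat \<Rightarrow> nat monoid" where
  "unit_group d = \<lparr>carrier = {u. u < d \<and> coprime u d}, monoid.mult = (\<lambda>a b. a * b mod d), one = 1 mod d\<rparr>"

lemma comm_group_unit_group:
  assumes "d > 0"
  shows "comm_group (unit_group d)"
proof (rule comm_groupI)
  fix u assume "u \<in> carrier (unit_group d)"
  then obtain v where v: "[u * v = 1] (mod d)"
    using cong_solve_coprime_nat[of u d] by (auto simp: unit_group_def)
  then have "coprime (u * v) d" by (metis cong_imp_coprime cong_sym coprime_1_left)
  then have "v mod d \<in> carrier (unit_group d)" using assms by (simp add: unit_group_def)
  moreover have "(v mod d) * u mod d = 1 mod d"
    using v unfolding cong_def by (metis mod_mult_left_eq mult.commute)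
  ultimately show "\<exists>y\<in>carrier (unit_group d). y \<otimes>\<^bsub>unit_group d\<^esub> u = \<one>\<^bsub>unit_group d\<^esub>"
    by (auto simp: unit_group_def)
qed (use assms in \<open>auto simp: unit_group_def mod_mult_left_eq mod_mult_right_eq mult_ac\<close>)

lemma squarefree_mult_imp_coprime:
  fixes a b :: nat
  assumes "squarefree (a * b)"
  shows "coprime a b"
proof -
  have "(gcd a b)\<^sup>2 dvd a * b" by (simp add: power2_eq_square mult_dvd_mono)
  then show ?thesis using assms squarefreeD by (metis coprime_iff_gcd_eq_1 nat_dvd_1_iff_1)
qed

lemma bij_betw_scaled_units:
  assumes "c > 0"
  shows "bij_betw (\<lambda>u. c * u) (carrier (unit_group d)) {l. l < c * d \<and> gcd l (c * d) = c}"
proof (rule bij_betwI[where g = "\<lambda>l. l div c"])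
  show "(\<lambda>u. c * u) \<in> carrier (unit_group d) \<rightarrow> {l. l < c * d \<and> gcd l (c * d) = c}"
    using assms by (auto simp: unit_group_def gcd_mult_left)
  show "(\<lambda>l. l div c) \<in> {l. l < c * d \<and> gcd l (c * d) = c} \<rightarrow> carrier (unit_group d)"
  proof
    fix l assume l: "l \<in> {l. l < c * d \<and> gcd l (c * d) = c}"
    then have "c dvd l" using gcd_dvd1[of l "c * d"] by simp
    then obtain u where u: "l = c * u" by (rule dvdE)
    then have "c * gcd u d = c" using l by (auto simp: gcd_mult_left)
    then have "coprime u d" using assms by (intro gcd_eq_1_imp_coprime) auto
    then show "l div c \<in> carrier (unit_group d)"
      using l u assms by (simp add: unit_group_def)
  qed
  show "c * (l div c) = l" if "l \<in> {l. l < c * d \<and> gcd l (c * d) = c}" for l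
    using that gcd_dvd1[of l "c * d"] by simp
qed (use assms in auto)

text \<open>Chinese remainder theorem in a window of \<open>c * d\<close> consecutive integers: the
  gcd condition means divisibility by \<open>c\<close> and being a unit modulo \<open>d\<close>, so
  \<open>e mod d\<close> determines \<open>e\<close>.\<close>

lemma bij_betw_mod_units:
  assumes "c > 0" "d > 0" and cop: "coprime c d"
  shows "bij_betw (\<lambda>e. e mod d) {e \<in> {a..<a + c * d}. gcd e (c * d) = c} (carrier (unit_group d))"
  unfolding bij_betw_def
proof
  let ?E = "{e \<in> {a..<a + c * d}. gcd e (c * d) = c}"
  have cE: "c dvd e" if "e \<in> ?E" for e using that gcd_dvd1[of e "c * d"] by simp
  show "inj_on (\<lambda>e. e mod d) ?E"
  proof (rule inj_onI)
    fix e e' assume e: "e \<in> ?E" "e' \<in> ?E" "e mod d = e' mod d"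
    have "[e = e'] (mod c)" using cE[OF e(1)] cE[OF e(2)] by (auto simp: cong_def)
    moreover have "[e = e'] (mod d)" using e(3) by (simp add: cong_def)
    ultimately have "[e = e'] (mod c * d)" using cop coprime_cong_mult_nat by blast
    then have "[(e - a) + a = (e' - a) + a] (mod c * d)" using e by simp
    then have "[e - a = e' - a] (mod c * d)" using cong_add_rcancel_nat by blast
    moreover have "e - a < c * d" "e' - a < c * d" using e by auto
    ultimately have "e - a = e' - a" using cong_less_modulus_unique_nat by blast
    then show "e = e'" using e by auto
  qed
  show "(\<lambda>e. e mod d) ` ?E = carrier (unit_group d)"
  proof (intro equalityI subsetI)
    fix u assume "u \<in> (\<lambda>e. e mod d) ` ?E"
    then obtain e where e: "e \<in> ?E" "u = e mod d" by auto
    have "gcd e d dvd gcd e (c * d)" by (intro gcd_greatest) (auto intro: dvd_mult)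
    moreover have "gcd e (c * d) = c" using e by simp
    ultimately have "gcd e d dvd c" by metis
    then have "gcd e d = 1" using cop by (metis coprime_common_divisor_nat gcd_dvd2)
    then have "coprime e d" by (rule gcd_eq_1_imp_coprime)
    then show "u \<in> carrier (unit_group d)"
      using e \<open>d > 0\<close> by (simp add: unit_group_def)
  next
    fix u assume u: "u \<in> carrier (unit_group d)"
    obtain x where x: "[x = u] (mod d)" "[x = 0] (mod c)"
      using binary_chinese_remainder_nat[of d c u 0] cop by (auto simp: coprime_commute)
    \<comment> \<open>This is the representative of \<open>x\<close> in the window starting at
      \<open>a\<close>; the summand \<open>(c * d - 1) * a\<close> plays the role of
      \<open>- a\<close> in the naturals.\<close>
    define e where "e = a + (x + (c * d - 1) * a) mod (c * d)"
    have "[e = a + (x + (c * d - 1) * a)] (mod (c * d))"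
      unfolding e_def by (simp add: cong_def mod_add_right_eq)
    also have "a + (x + (c * d - 1) * a) = x + (c * d) * a"
      using assms by (cases "c * d") auto
    finally have ex: "[e = x] (mod (c * d))" by (simp add: cong_def)
    have ed: "[e = u] (mod d)" using cong_dvd_modulus_nat[OF ex, of d] x(1) cong_trans by auto
    have "[e = 0] (mod c)" using cong_dvd_modulus_nat[OF ex, of c] x(2) cong_trans by auto
    then have ec: "c dvd e" by (simp add: cong_0_iff)
    have "coprime u d" using u by (simp add: unit_group_def)
    then have "coprime e d" using cong_imp_coprime[OF cong_sym[OF ed]] by simp
    then have "gcd e (c * d) = c" using ec by (simp add: gcd_mult_right_right_cancel)
    moreover have "e \<in> {a..<a + c * d}" using assms by (simp add: e_def)
    moreover have "e mod d = u" using ed u by (simp add: cong_def unit_group_def)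
    ultimately show "u \<in> (\<lambda>e. e mod d) ` ?E" by blast
  qed
qed

text \<open>Each window contributes one copy of the unit group through \<open>e mod d\<close>, and
  \<open>l = c * u\<close> turns residues into units. The identity
  \<open>c * (u * v mod d) = c * u * v mod (c * d)\<close> carries double rearrangements
  over.\<close>

lemma card_class_assignments_ge:
  fixes a b c d :: nat
  defines "L \<equiv> {l. l < c * d \<and> gcd l (c * d) = c}"
    and "E \<equiv> {e \<in> {a..<a + c * d} \<union> {b..<b + c * d}. gcd e (c * d) = c}"
  assumes pos: "c > 0" "d > 0" and cop: "coprime c d" and disj: "{a..<a + c * d} \<inter> {b..<b + c * d} = {}"
  shows "4 ^ card L \<le> 2 * card {r \<in> E \<rightarrow>\<^sub>E (UNIV :: bool set) \<times> L.
      bij_betw r E (UNIV \<times> L) \<and> bij_betw (\<lambda>e. (fst (r e), snd (r e) * e mod (c * d))) E (UNIV \<times> L)}"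
    (is "_ \<le> 2 * card ?T")
proof -
  let ?G = "unit_group d"
  interpret comm_group ?G using comm_group_unit_group[OF \<open>d > 0\<close>] .
  define E1 where "E1 = {e \<in> {a..<a + c * d}. gcd e (c * d) = c}"
  define E2 where "E2 = {e \<in> {b..<b + c * d}. gcd e (c * d) = c}"
  have E: "E = E1 \<union> E2" by (auto simp: E_def E1_def E2_def)
  have fin: "finite (carrier ?G)" by (simp add: unit_group_def)
  have bL: "bij_betw (\<lambda>u. c * u) (carrier ?G) L" unfolding L_def by (rule bij_betw_scaled_units[OF pos(1)])
  have bB: "bij_betw (map_prod (\<lambda>x. x) (\<lambda>u. c * u)) (UNIV \<times> carrier ?G) ((UNIV :: bool set) \<times> L)"
    using bL unfolding bij_betw_def by (intro conjI map_prod_inj_on) (auto simp: map_prod_surj_on)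
  have cL: "card L = order ?G" using bL by (simp add: order_def bij_betw_same_card)
  let ?R = "{r \<in> E \<rightarrow>\<^sub>E (UNIV :: bool set) \<times> carrier ?G. bij_betw r E (UNIV \<times> carrier ?G) \<and>
      bij_betw (\<lambda>e. (fst (r e), snd (r e) \<otimes>\<^bsub>?G\<^esub> (e mod d))) E (UNIV \<times> carrier ?G)}"
  have main: "4 ^ order ?G \<le> 2 * card ?R"
    unfolding E
  proof (rule card_double_rearrangements_ge[OF fin])
    show "E1 \<inter> E2 = {}" using disj by (auto simp: E1_def E2_def)
    show "bij_betw (\<lambda>e. e mod d) E1 (carrier ?G)" "bij_betw (\<lambda>e. e mod d) E2 (carrier ?G)"
      unfolding E1_def E2_def using bij_betw_mod_units[OF pos cop] by blast+
  qed
  define F where "F r = (\<lambda>e\<in>E. map_prod (\<lambda>x :: bool. x) (\<lambda>u. c * u) (r e))" for r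
  have "card ?R \<le> card ?T"
  proof (rule card_inj_on_le)
    show "inj_on F ?R"
    proof (rule inj_onI)
      fix r s assume r: "r \<in> ?R" "s \<in> ?R" "F r = F s"
      show "r = s"
      proof
        fix e
        show "r e = s e"
        proof (cases "e \<in> E")
          case True
          then have "F r e = F s e" using r by simp
          then show ?thesis using True pos by (auto simp: F_def map_prod_def split: prod.splits)
        next
          case False
          then show ?thesis using r by (auto simp: PiE_def extensional_def)
        qed
      qed
    qed
    show "F ` ?R \<subseteq> ?T"
    proof (rule image_subsetI)
      fix r assume r: "r \<in> ?R"
      have "bij_betw (map_prod (\<lambda>x :: bool. x) (\<lambda>u. c * u) \<circ> r) E (UNIV \<times> L)"
        using r bB by (auto intro: bij_betw_trans)
      then have 1: "bij_betw (F r) E (UNIV \<times> L)"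
        by (rule bij_betw_cong[THEN iffD1, rotated]) (auto simp: F_def)
      have "bij_betw (map_prod (\<lambda>x :: bool. x) (\<lambda>u. c * u) \<circ> (\<lambda>e. (fst (r e), snd (r e) \<otimes>\<^bsub>?G\<^esub> (e mod d)))) E (UNIV \<times> L)"
        using r bB by (auto intro: bij_betw_trans)
      then have 2: "bij_betw (\<lambda>e. (fst (F r e), snd (F r e) * e mod (c * d))) E (UNIV \<times> L)"
      proof (rule bij_betw_cong[THEN iffD1, rotated])
        fix e assume "e \<in> E"
        then show "(map_prod (\<lambda>x :: bool. x) (\<lambda>u. c * u) \<circ> (\<lambda>e. (fst (r e), snd (r e) \<otimes>\<^bsub>?G\<^esub> (e mod d)))) e
            = (fst (F r e), snd (F r e) * e mod (c * d))"
          by (simp add: F_def unit_group_def mod_mult_right_eq mult.assoc flip: mult_mod_right)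
      qed
      have "F r \<in> E \<rightarrow>\<^sub>E UNIV \<times> L"
        using 1 by (auto simp: bij_betw_def PiE_def F_def Pi_iff)
      then show "F r \<in> ?T" using 1 2 by simp
    qed
    have "finite E" "finite L" by (auto simp: E_def L_def)
    then show "finite ?T" by (intro finite_subset[of ?T "E \<rightarrow>\<^sub>E UNIV \<times> L"] finite_PiE) auto
  qed
  then show ?thesis using main cL by simp
qed

text \<open>The gcd with \<open>m\<close> cuts exponents and residues into classes indexed by the
  divisors. Squarefreeness makes each divisor coprime to its cofactor, so the class bound applies;
  choices in different classes are independent, and one factor \<open>2\<close> is lost per
  divisor.\<close>

lemma card_exponent_assignments_ge:
  fixes m a b :: nat
  defines "E \<equiv> {a..<a + m} \<union> {b..<b + m}"
  assumes "squarefree m" and disj: "{a..<a + m} \<inter> {b..<b + m} = {}"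
  shows "4 ^ m \<le> 2 ^ card {d. d dvd m} * card {r \<in> E \<rightarrow>\<^sub>E (UNIV :: bool set) \<times> {..<m}.
      bij_betw r E (UNIV \<times> {..<m}) \<and> bij_betw (\<lambda>e. (fst (r e), snd (r e) * e mod m)) E (UNIV \<times> {..<m})}"
    (is "_ \<le> _ * card ?T")
proof -
  have m: "m > 0" using assms(2) by (cases m) auto
  define D where "D = {c. c dvd m}"
  have finD: "finite D" using m by (simp add: D_def)
  define L where "L c = {l. l < m \<and> gcd l m = c}" for c
  define EE where "EE c = {e \<in> E. gcd e m = c}" for c
  define T where "T c = {r \<in> EE c \<rightarrow>\<^sub>E (UNIV :: bool set) \<times> L c. bij_betw r (EE c) (UNIV \<times> L c) \<and>
      bij_betw (\<lambda>e. (fst (r e), snd (r e) * e mod m)) (EE c) (UNIV \<times> L c)}" for c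
  have finT: "finite (T c)" for c
    by (rule finite_subset[of _ "EE c \<rightarrow>\<^sub>E UNIV \<times> L c"])
      (auto simp: T_def EE_def L_def E_def intro!: finite_PiE)
  have UL: "(\<Union>c\<in>D. L c) = {..<m}" by (auto simp: D_def L_def)
  have UUL: "(\<Union>c\<in>D. (UNIV :: bool set) \<times> L c) = UNIV \<times> {..<m}" using UL by auto
  have UE: "(\<Union>c\<in>D. EE c) = E" by (auto simp: D_def EE_def)
  have T: "4 ^ card (L c) \<le> 2 * card (T c)" if "c \<in> D" for c
  proof -
    obtain d where d: "m = c * d" using \<open>c \<in> D\<close> by (auto simp: D_def)
    show ?thesis
      using card_class_assignments_ge[of c d a b] m squarefree_mult_imp_coprime[of c d] assms(2) disj
      unfolding T_def EE_def L_def E_def d by simp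
  qed
  \<comment> \<open>An exponent is served by the component of \<open>t\<close> belonging to its own
    gcd class.\<close>
  define F where "F t = (\<lambda>e\<in>E. t (gcd e m) e)" for t :: "nat \<Rightarrow> nat \<Rightarrow> bool \<times> nat"
  have "card (Pi\<^sub>E D T) \<le> card ?T"
  proof (rule card_inj_on_le)
    show "inj_on F (Pi\<^sub>E D T)"
    proof (rule inj_onI)
      fix s t assume st: "s \<in> Pi\<^sub>E D T" "t \<in> Pi\<^sub>E D T" "F s = F t"
      show "s = t"
      proof (rule PiE_ext[OF st(1,2)])
        fix c assume c: "c \<in> D"
        then have sc: "s c \<in> T c" "t c \<in> T c" using st by auto
        show "s c = t c"
        proof
          fix e
          show "s c e = t c e"
          proof (cases "e \<in> EE c")
            case True
            then have "F s e = s c e" "F t e = t c e" by (auto simp: F_def EE_def)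
            then show ?thesis using st(3) by simp
          next
            case False
            then show ?thesis using sc by (auto simp: T_def PiE_def extensional_def)
          qed
        qed
      qed
    qed
    show "F ` Pi\<^sub>E D T \<subseteq> ?T"
    proof (rule image_subsetI)
      fix t assume t: "t \<in> Pi\<^sub>E D T"
      have disjL: "disjoint_family_on (\<lambda>c. (UNIV :: bool set) \<times> L c) D"
        by (auto simp: disjoint_family_on_def L_def)
      have Ft: "F t e = t c e" if "e \<in> EE c" for c e using that by (auto simp: F_def EE_def)
      have 1: "bij_betw (F t) E (UNIV \<times> {..<m})"
        unfolding UUL[symmetric] UE[symmetric]
      proof (rule bij_betw_UNION_disjoint[OF disjL])
        fix c assume "c \<in> D"
        then have "bij_betw (t c) (EE c) (UNIV \<times> L c)" using t by (auto simp: T_def dest: PiE_mem)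
        then show "bij_betw (F t) (EE c) (UNIV \<times> L c)"
          by (rule bij_betw_cong[THEN iffD1, rotated]) (simp add: Ft)
      qed
      have 2: "bij_betw (\<lambda>e. (fst (F t e), snd (F t e) * e mod m)) E (UNIV \<times> {..<m})"
        unfolding UUL[symmetric] UE[symmetric]
      proof (rule bij_betw_UNION_disjoint[OF disjL])
        fix c assume "c \<in> D"
        then have "bij_betw (\<lambda>e. (fst (t c e), snd (t c e) * e mod m)) (EE c) (UNIV \<times> L c)"
          using t by (auto simp: T_def dest: PiE_mem)
        then show "bij_betw (\<lambda>e. (fst (F t e), snd (F t e) * e mod m)) (EE c) (UNIV \<times> L c)"
          by (rule bij_betw_cong[THEN iffD1, rotated]) (simp add: Ft)
      qed
      have "F t \<in> E \<rightarrow>\<^sub>E UNIV \<times> {..<m}"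
        using 1 by (auto simp: bij_betw_def PiE_def F_def Pi_iff)
      then show "F t \<in> ?T" using 1 2 by simp
    qed
    show "finite ?T"
      by (rule finite_subset[of _ "E \<rightarrow>\<^sub>E UNIV \<times> {..<m}"]) (auto simp: E_def intro!: finite_PiE)
  qed
  then have le: "(\<Prod>c\<in>D. card (T c)) \<le> card ?T" using finD by (simp add: card_PiE)
  \<comment> \<open>The class sizes add up to \<open>m\<close>, so the factors
    \<open>4 ^ card (L c)\<close> multiply to \<open>4 ^ m\<close>.\<close>
  have "card (\<Union>c\<in>D. L c) = (\<Sum>c\<in>D. card (L c))"
    using finD by (intro card_UN_disjoint) (auto simp: L_def)
  then have "4 ^ m = (\<Prod>c\<in>D. (4::nat) ^ card (L c))" by (simp add: UL power_sum)
  also have "\<dots> \<le> (\<Prod>c\<in>D. 2 * card (T c))" using T by (intro prod_mono) auto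
  also have "\<dots> = 2 ^ card D * (\<Prod>c\<in>D. card (T c))" by (simp add: prod.distrib)
  also have "\<dots> \<le> 2 ^ card D * card ?T" using le by simp
  finally show ?thesis by (simp add: D_def)
qed

section \<open>Exponential orthomorphisms modulo twice a prime\<close>

text \<open>
  The pair \<open>(c, l)\<close> encodes the residue modulo \<open>2 p\<close> that is congruent to \<open>g ^ l\<close> modulo \<open>p\<close> and is odd
  iff \<open>c\<close>; only the residues \<open>0\<close> and \<open>p\<close> are missed.
\<close>
definition residue_of_log :: "nat \<Rightarrow> nat \<Rightarrow> bool \<times> nat \<Rightarrow> nat" where
  "residue_of_log p g = (\<lambda>(c, l). let y = g ^ l mod p in if odd y = c then y else y + p)"

section \<open>Discrete logarithms and parity as coordinates modulo twice a prime\<close>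

context
  fixes p g :: nat
  assumes p: "prime p" "odd p" and g: "residue_primroot p g"
begin

lemma power_primroot_mod_period: "g ^ (l mod (p - 1)) mod p = g ^ l mod p"
proof -
  have "coprime p g" using g by (simp add: residue_primroot_def)
  then have "\<not> p dvd g" using p by (metis coprime_absorb_left not_prime_unit)
  then have "[g ^ (p - 1) = 1] (mod p)" using fermat_theorem p by blast
  then have "[(g ^ (p - 1)) ^ (l div (p - 1)) * g ^ (l mod (p - 1)) = 1 ^ (l div (p - 1)) * g ^ (l mod (p - 1))] (mod p)"
    by (intro cong_mult cong_pow cong_refl)
  then show ?thesis by (simp add: cong_def flip: power_mult power_add)
qed

lemma power_primroot_bounds: "0 < g ^ l mod p" "g ^ l mod p < p"
proof -
  have "coprime p g" using g by (simp add: residue_primroot_def)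
  then have "\<not> p dvd g ^ l" using p by (metis coprime_absorb_left coprime_power_right_iff not_prime_unit)
  then show "0 < g ^ l mod p" by (simp add: dvd_eq_mod_eq_0)
  show "g ^ l mod p < p" using p by (simp add: prime_gt_0_nat)
qed

lemma inj_on_power_primroot: "inj_on (\<lambda>l. g ^ l mod p) {..<p - 1}"
  using residue_primroot_is_generator[OF prime_gt_1_nat[OF p(1)] g] p
  by (simp add: bij_betw_def totient_prime)

lemma residue_of_log:
  "residue_of_log p g (c, l) mod p = g ^ l mod p" "odd (residue_of_log p g (c, l)) = c"
  "residue_of_log p g (c, l) < 2 * p"
  using power_primroot_bounds[of l] p by (auto simp: residue_of_log_def Let_def)

text \<open>The moduli \<open>2\<close> and \<open>p\<close> are coprime, so the two congruences
  combine modulo \<open>2 * p\<close>.\<close>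

lemma eq_if_same_residue_and_parity:
  fixes x y :: nat
  assumes "x < 2 * p" "y < 2 * p" "x mod p = y mod p" "odd x = odd y"
  shows "x = y"
proof -
  have "[x = y] (mod 2)" using assms by (auto simp: cong_def mod_2_eq_odd)
  moreover have "[x = y] (mod p)" using assms by (simp add: cong_def)
  moreover have "coprime 2 p" using p by simp
  ultimately have "[x = y] (mod 2 * p)" using coprime_cong_mult_nat by blast
  then show ?thesis using assms cong_less_modulus_unique_nat by blast
qed

lemma bij_betw_residue_of_log:
  "bij_betw (residue_of_log p g) (UNIV \<times> {..<p - 1}) ({1..2 * p - 1} - {p})"
proof -
  have inj: "inj_on (residue_of_log p g) (UNIV \<times> {..<p - 1})"
  proof (rule inj_onI)
    fix z z' assume "z \<in> (UNIV :: bool set) \<times> {..<p - 1}" "z' \<in> (UNIV :: bool set) \<times> {..<p - 1}"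
      "residue_of_log p g z = residue_of_log p g z'"
    then obtain c c' l l' where z: "z = (c, l)" "z' = (c', l')"
      and l: "l \<in> {..<p - 1}" "l' \<in> {..<p - 1}"
      and eq: "residue_of_log p g (c, l) = residue_of_log p g (c', l')" by auto
    then have "g ^ l mod p = g ^ l' mod p" by (metis residue_of_log(1))
    then have "l = l'" using inj_on_power_primroot l by (auto dest: inj_onD)
    have "c = c'"
      using residue_of_log(2)[of c l, unfolded eq] residue_of_log(2)[of c' l'] by blast
    then show "z = z'" using \<open>l = l'\<close> by (simp add: z)
  qed
  have sub: "residue_of_log p g ` (UNIV \<times> {..<p - 1}) \<subseteq> {1..2 * p - 1} - {p}"
  proof (rule image_subsetI)
    fix z :: "bool \<times> nat"
    obtain c l where z: "z = (c, l)" by (metis surj_pair)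
    have "residue_of_log p g z mod p > 0" using power_primroot_bounds[of l] by (simp add: z residue_of_log)
    then have "residue_of_log p g z \<noteq> 0" "residue_of_log p g z \<noteq> p" by (metis less_irrefl mod_0, metis less_irrefl mod_self)
    then show "residue_of_log p g z \<in> {1..2 * p - 1} - {p}"
      using residue_of_log(3)[of c l] by (auto simp: z)
  qed
  \<comment> \<open>An injection into a finite set of the same size is onto.\<close>
  have "card ({1..2 * p - 1} - {p}) = 2 * (p - 1)" using prime_gt_1_nat[OF p(1)] by simp
  also have "\<dots> = card (residue_of_log p g ` (UNIV \<times> {..<p - 1}))"
    using inj by (simp add: card_image card_cartesian_product)
  finally have "residue_of_log p g ` (UNIV \<times> {..<p - 1}) = {1..2 * p - 1} - {p}"
    using sub by (intro card_subset_eq) auto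
  then show ?thesis using inj by (simp add: bij_betw_def)
qed

text \<open>A power keeps the parity and multiplies the logarithm. Positivity of \<open>e\<close>
  matters for parity: an even residue to the power \<open>0\<close> becomes odd.\<close>

lemma residue_of_log_power:
  assumes "e > 0"
  shows "residue_of_log p g z ^ e mod (2 * p) = residue_of_log p g (fst z, snd z * e mod (p - 1))"
proof -
  obtain c l where z: "z = (c, l)" by (metis surj_pair)
  let ?x = "residue_of_log p g (c, l)"
  have "?x ^ e mod (2 * p) mod p = ?x ^ e mod p" by (simp add: mod_mod_cancel)
  also have "\<dots> = (g ^ l) ^ e mod p" by (metis power_mod residue_of_log(1))
  also have "\<dots> = g ^ (l * e mod (p - 1)) mod p"
    by (simp only: power_primroot_mod_period power_mult)
  finally have "?x ^ e mod (2 * p) mod p = residue_of_log p g (c, l * e mod (p - 1)) mod p"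
    by (simp add: residue_of_log)
  moreover have "odd (?x ^ e mod (2 * p)) = odd (?x ^ e)" by (metis dvd_mod_iff dvd_triv_left)
  then have "odd (?x ^ e mod (2 * p)) = odd (residue_of_log p g (c, l * e mod (p - 1)))"
    using assms by (simp add: residue_of_log)
  moreover have "?x ^ e mod (2 * p) < 2 * p" using p by (simp add: prime_gt_0_nat)
  ultimately show ?thesis
    unfolding z fst_conv snd_conv using residue_of_log(3) eq_if_same_residue_and_parity by blast
qed

text \<open>An assignment sends each exponent in \<open>E\<close> to the encoded residue that
  receives it, so together with \<open>e0\<close> going to \<open>p\<close> it describes the inverse
  of an orthomorphism.\<close>

lemma card_orthomorphisms_fixing_exponent_ge:
  fixes a b e0 :: nat
  defines "E \<equiv> {a..<a + (p - 1)} \<union> {b..<b + (p - 1)}"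
  assumes sf: "squarefree (p - 1)" and disj: "{a..<a + (p - 1)} \<inter> {b..<b + (p - 1)} = {}"
    and E: "insert e0 E = {1..2 * p - 1}" "e0 \<notin> E"
  shows "4 ^ (p - 1) \<le> 2 ^ card {d. d dvd p - 1} *
    card {\<sigma>. exponential_orthomorphism (2 * p) \<sigma> \<and> \<sigma> p = e0}" (is "_ \<le> _ * card ?S")
proof -
  let ?U = "(UNIV :: bool set) \<times> {..<p - 1}" and ?\<gamma> = "residue_of_log p g"
  let ?N = "{1..2 * p - 1}"
  define T where "T = {r \<in> E \<rightarrow>\<^sub>E ?U. bij_betw r E ?U \<and>
      bij_betw (\<lambda>e. (fst (r e), snd (r e) * e mod (p - 1))) E ?U}"
  define F where "F r = (\<lambda>e. if e \<in> E then ?\<gamma> (r e) else if e = e0 then p else e)"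
    for r :: "nat \<Rightarrow> bool \<times> nat"
  have pN: "p \<in> ?N" using prime_gt_1_nat[OF p(1)] by auto
  have Epos: "e > 0" if "e \<in> E" for e
  proof -
    have "e \<in> ?N" using that E(1) by blast
    then show ?thesis by simp
  qed
  have e0: "e0 \<in> ?N" using E(1) by blast
  \<comment> \<open>Needed both for \<open>F r\<close> and for the map of powers: each sends
    \<open>E\<close> onto everything but \<open>p\<close>, and \<open>e0\<close> to
    \<open>p\<close>.\<close>
  have ext: "bij_betw f ?N ?N" if "bij_betw f E (?N - {p})" "f e0 = p" for f :: "nat \<Rightarrow> nat"
  proof -
    have "bij_betw f (E \<union> {e0}) ((?N - {p}) \<union> {p})"
      using that by (intro bij_betw_combine) (auto simp: bij_betw_def)
    moreover have "E \<union> {e0} = ?N" using E(1) by simp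
    moreover have "(?N - {p}) \<union> {p} = ?N" using pN by blast
    ultimately show ?thesis by simp
  qed
  have F: "F r permutes ?N" "exponential_orthomorphism (2 * p) (inv_into UNIV (F r))"
    "inv_into UNIV (F r) p = e0" if r: "r \<in> T" for r
  proof -
    have "bij_betw (?\<gamma> \<circ> r) E (?N - {p})"
      using r by (intro bij_betw_trans[OF _ bij_betw_residue_of_log]) (simp add: T_def)
    then have "bij_betw (F r) E (?N - {p})"
      by (subst bij_betw_cong[of E "F r" "?\<gamma> \<circ> r"]) (simp_all add: F_def)
    moreover have Fe0: "F r e0 = p" using E by (simp add: F_def)
    ultimately have b: "bij_betw (F r) ?N ?N" by (rule ext)
    moreover have "F r x = x" if "x \<notin> ?N" for x using that E(1) e0 by (auto simp: F_def)
    ultimately show perm: "F r permutes ?N" by (rule bij_imp_permutes)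
    show "inv_into UNIV (F r) p = e0"
      using Fe0 perm by (metis permutes_inverses(2))
    have "bij_betw (?\<gamma> \<circ> (\<lambda>e. (fst (r e), snd (r e) * e mod (p - 1)))) E (?N - {p})"
      using r by (intro bij_betw_trans[OF _ bij_betw_residue_of_log]) (simp add: T_def)
    then have "bij_betw (\<lambda>e. F r e ^ e mod (2 * p)) E (?N - {p})"
      by (rule bij_betw_cong[THEN iffD1, rotated]) (simp add: F_def residue_of_log_power Epos)
    \<comment> \<open>A positive power of \<open>p\<close> is odd and vanishes modulo
      \<open>p\<close>, hence is congruent to \<open>p\<close> modulo \<open>2 * p\<close>.\<close>
    moreover have "F r e0 ^ e0 mod (2 * p) = p"
    proof (rule eq_if_same_residue_and_parity)
      have e0pos: "e0 > 0" using e0 by simp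
      have "p ^ e0 mod (2 * p) mod p = p ^ e0 mod p" by (simp add: mod_mod_cancel)
      then show "F r e0 ^ e0 mod (2 * p) mod p = p mod p" using e0pos by (simp add: Fe0)
      have "odd (p ^ e0 mod (2 * p)) = odd (p ^ e0)" by (metis dvd_mod_iff dvd_triv_left)
      then show "odd (F r e0 ^ e0 mod (2 * p)) = odd p" using p by (simp add: Fe0)
    qed (use prime_gt_0_nat[OF p(1)] in auto)
    ultimately have power_bij: "bij_betw (\<lambda>e. F r e ^ e mod (2 * p)) ?N ?N"
      by (rule ext[of "\<lambda>e. F r e ^ e mod (2 * p)"])
    have "bij_betw (inv_into UNIV (F r)) ?N ?N"
      using permutes_inv[OF perm] by (rule permutes_imp_bij)
    \<comment> \<open>With \<open>\<sigma>\<close> the inverse of \<open>F r\<close>, substituting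
      \<open>e = \<sigma> x\<close> turns \<open>F r e ^ e\<close> into
      \<open>x ^ \<sigma> x\<close>.\<close>
    from bij_betw_trans[OF this power_bij]
    have "bij_betw ((\<lambda>e. F r e ^ e mod (2 * p)) \<circ> inv_into UNIV (F r)) ?N ?N" .
    then have "bij_betw (\<lambda>x. x ^ inv_into UNIV (F r) x mod (2 * p)) ?N ?N"
      by (rule bij_betw_cong[THEN iffD1, rotated]) (simp add: permutes_inverses[OF perm])
    then show "exponential_orthomorphism (2 * p) (inv_into UNIV (F r))"
      unfolding exponential_orthomorphism_def using permutes_inv[OF perm] by blast
  qed
  have "card T \<le> card ?S"
  proof (rule card_inj_on_le)
    show "inj_on (\<lambda>r. inv_into UNIV (F r)) T"
    proof (rule inj_onI)
      fix r s assume rs: "r \<in> T" "s \<in> T" "inv_into UNIV (F r) = inv_into UNIV (F s)"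
      then have Feq: "F r = F s" using F(1)[OF rs(1)] F(1)[OF rs(2)] by (metis permutes_inv_inv)
      have rT: "r \<in> E \<rightarrow>\<^sub>E ?U" "s \<in> E \<rightarrow>\<^sub>E ?U" using rs by (auto simp: T_def)
      show "r = s"
      proof (rule PiE_ext[OF rT])
        fix e assume e: "e \<in> E"
        then have "?\<gamma> (r e) = ?\<gamma> (s e)" using fun_cong[OF Feq, of e] by (simp add: F_def)
        moreover have "r e \<in> ?U" "s e \<in> ?U" using rT e by blast+
        ultimately show "r e = s e" using bij_betw_residue_of_log by (metis bij_betw_def inj_onD)
      qed
    qed
    show "(\<lambda>r. inv_into UNIV (F r)) ` T \<subseteq> ?S" using F by blast
    show "finite ?S"
      by (rule finite_subset[OF _ finite_permutations[of "?N"]])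
        (auto simp: exponential_orthomorphism_def)
  qed
  moreover have "4 ^ (p - 1) \<le> 2 ^ card {d. d dvd p - 1} * card T"
    using card_exponent_assignments_ge[OF sf disj] by (simp add: T_def E_def)
  ultimately show ?thesis by (meson le_trans mult_le_mono2)
qed

text \<open>
  The point \<open>p\<close> is fixed by all powers, and removing any of the three exponents congruent to \<open>1\<close>
  modulo \<open>p - 1\<close> leaves two complete residue systems.
\<close>
lemma card_exponential_orthomorphisms_ge:
  assumes sf: "squarefree (p - 1)"
  shows "3 * 4 ^ (p - 1) \<le> 2 ^ card {d. d dvd p - 1} * card {\<sigma>. exponential_orthomorphism (2 * p) \<sigma>}"
proof -
  define S where "S e = {\<sigma>. exponential_orthomorphism (2 * p) \<sigma> \<and> \<sigma> p = e}" for e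
  define C where "C = (2 :: nat) ^ card {d. d dvd p - 1}"
  have p1: "p > 1" using p prime_gt_1_nat by blast
  \<comment> \<open>Deleting \<open>1\<close> leaves the windows \<open>{2..p}\<close> and
    \<open>{p + 1..2 * p - 1}\<close>. Deleting \<open>p\<close> or \<open>2 * p - 1\<close> leaves
    \<open>{1..p - 1}\<close> and the \<open>p - 1\<close> integers from \<open>p + 1\<close> or
    from \<open>p\<close> on.\<close>
  have S: "4 ^ (p - 1) \<le> C * card (S 1)"
    unfolding S_def C_def using p1
    by (intro card_orthomorphisms_fixing_exponent_ge[OF sf, of 2 "p + 1"]) auto
  have Sp: "4 ^ (p - 1) \<le> C * card (S p)"
    unfolding S_def C_def using p1
    by (intro card_orthomorphisms_fixing_exponent_ge[OF sf, of 1 "p + 1"]) auto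
  have Sl: "4 ^ (p - 1) \<le> C * card (S (2 * p - 1))"
    unfolding S_def C_def using p1
    by (intro card_orthomorphisms_fixing_exponent_ge[OF sf, of 1 p]) auto
  have fin: "finite {\<sigma>. exponential_orthomorphism (2 * p) \<sigma>}"
    by (rule finite_subset[OF _ finite_permutations[of "{1..2 * p - 1}"]])
      (auto simp: exponential_orthomorphism_def)
  then have finS: "finite (S e)" for e by (rule rev_finite_subset) (auto simp: S_def)
  \<comment> \<open>The three sets are disjoint, since \<open>1\<close>, \<open>p\<close> and
    \<open>2 * p - 1\<close> are different values of \<open>\<sigma> p\<close>.\<close>
  have "card (S 1) + card (S p) + card (S (2 * p - 1)) = card (S 1 \<union> S p \<union> S (2 * p - 1))"
    using finS p1 by (subst card_Un_disjoint; (subst card_Un_disjoint)?) (auto simp: S_def)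
  also have "\<dots> \<le> card {\<sigma>. exponential_orthomorphism (2 * p) \<sigma>}"
    using fin by (intro card_mono) (auto simp: S_def)
  finally have "C * (card (S 1) + card (S p) + card (S (2 * p - 1)))
      \<le> C * card {\<sigma>. exponential_orthomorphism (2 * p) \<sigma>}" by (rule mult_left_mono) simp
  then show ?thesis using S Sp Sl unfolding C_def[symmetric] by (simp add: distrib_left)
qed

end

section \<open>Divisor counts and comparison with the claimed bound\<close>

lemma card_divisors_mult_le:
  fixes a b :: nat
  assumes "a > 0" "b > 0"
  shows "card {d. d dvd a * b} \<le> card {d. d dvd a} * card {d. d dvd b}"
proof -
  have "{d. d dvd a * b} \<subseteq> (\<lambda>(x, y). x * y) ` ({d. d dvd a} \<times> {d. d dvd b})"
  proof
    fix d assume "d \<in> {d. d dvd a * b}"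
    then obtain x y where "d = x * y" "x dvd a" "y dvd b" using division_decomp[of d a b] by auto
    then show "d \<in> (\<lambda>(x, y). x * y) ` ({d. d dvd a} \<times> {d. d dvd b})"
      by (intro image_eqI[of _ _ "(x, y)"]) auto
  qed
  then have "card {d. d dvd a * b} \<le> card ({d. d dvd a} \<times> {d. d dvd b})"
    using assms by (intro surj_card_le) auto
  then show ?thesis by (simp add: card_cartesian_product)
qed

text \<open>Each further prime factor at most doubles the number of divisors.\<close>

lemma card_divisors_prod_primes_le:
  fixes q :: "'i \<Rightarrow> nat"
  assumes "finite I" "\<And>i. i \<in> I \<Longrightarrow> prime (q i)"
  shows "card {d. d dvd (\<Prod>i\<in>I. q i)} \<le> 2 ^ card I"
  using assms
proof (induction I rule: finite_induct)
  case (insert i I)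
  have "{d. d dvd q i} = {1, q i}" using insert.prems by (auto simp: prime_nat_iff)
  moreover have "q i \<noteq> 1" using insert.prems[of i] by auto
  ultimately have "card {d. d dvd q i} = 2" by simp
  moreover have "(\<Prod>i\<in>I. q i) > 0" "q i > 0"
    using insert.prems by (auto intro!: prod_pos simp: prime_gt_0_nat)
  ultimately have "card {d. d dvd q i * (\<Prod>i\<in>I. q i)} \<le> 2 * card {d. d dvd (\<Prod>i\<in>I. q i)}"
    using card_divisors_mult_le[of "q i" "\<Prod>i\<in>I. q i"] by simp
  also have "\<dots> \<le> 2 * 2 ^ card I" using insert by simp
  finally show ?case using insert.hyps by simp
qed simp

text \<open>Passing from \<open>k\<close> to \<open>k + 1\<close> multiplies the left side by
  \<open>3 * (k + 3)\<close>, and both \<open>3\<close> and \<open>k + 3\<close> are at most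
  \<open>m\<close>.\<close>

lemma fact_mult_power3_le:
  fixes m :: nat
  assumes "2 * 3 ^ k \<le> m"
  shows "fact (k + 2) * 3 ^ k \<le> m ^ (2 * k + 1)"
  using assms
proof (induction k)
  case (Suc k)
  have "k + 3 \<le> 2 * 3 ^ Suc k" by (induction k) auto
  then have k3: "k + 3 \<le> m" "3 \<le> m" using Suc.prems by linarith+
  have "fact (Suc k + 2) * 3 ^ Suc k = (k + 3) * 3 * (fact (k + 2) * 3 ^ k)"
    by (simp add: eval_nat_numeral algebra_simps)
  also have "\<dots> \<le> m * m * m ^ (2 * k + 1)"
    using k3 Suc by (intro mult_mono) auto
  finally show ?case by simp
qed simp

text \<open>After halving, this compares the exponent \<open>2 * k + 1\<close> with
  \<open>3 * 2 powr (k - 1)\<close>, which is not an integer for \<open>k = 0\<close>.\<close>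

lemma odd_exponent_le: "2 * (2 * k + 1) \<le> 3 * 2 ^ (k :: nat)"
proof (induction k)
  case (Suc k)
  show ?case
  proof (cases "k = 0")
    case False
    then have "4 \<le> 3 * (2 :: nat) ^ k" using power_increasing[of 1 k "2 :: nat"] by simp
    then show ?thesis using Suc by simp
  qed simp
qed simp

theorem theorem1p5:
  fixes p n k :: nat and q :: "nat \<Rightarrow> nat"
  assumes "prime p" and "odd p"
    and "\<And>i. i \<in> {1..k} \<Longrightarrow> prime (q i) \<and> odd (q i)"
    and "inj_on q {1..k}"
    and "p - 1 = 2 * (\<Prod>i = 1..k. q i)"
    and "n = 2 * p"
  shows "real (card {\<sigma>. exponential_orthomorphism n \<sigma>}) \<ge>
    (fact (k + 2) * 3 ^ (k + 1) * 2 powr (real n - 2 powr (real k - 1))) /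
    (4 * (real n - 2) powr (3 * 2 powr (real k - 1)))"
proof -
  define m where "m = p - 1"
  define N where "N = real (card {\<sigma>. exponential_orthomorphism n \<sigma>})"
  have mq: "m = 2 * (\<Prod>i = 1..k. q i)" unfolding m_def by (rule assms(5))
  have p1: "p > 1" using assms(1) prime_gt_1_nat by blast
  have pq: "prime (q i)" "odd (q i)" "q i \<ge> 3" if "i \<in> {1..k}" for i
  proof -
    show "prime (q i)" "odd (q i)" using assms(3)[OF that] by auto
    then show "q i \<ge> 3" using prime_ge_2_nat[of "q i"] by (cases "q i = 2") auto
  qed
  have sfq: "squarefree (\<Prod>i = 1..k. q i)"
    using assms(4) pq by (intro squarefree_prod_coprime squarefree_prime)
      (auto intro!: primes_coprime dest: inj_onD)
  have "squarefree m"
    unfolding mq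
  proof (rule squarefree_mult_coprime)
    show "coprime 2 (\<Prod>i = 1..k. q i)" using pq by (intro prod_coprime_right) auto
    show "squarefree (2 :: nat)" by (intro squarefree_prime) simp
  qed (fact sfq)
  moreover obtain g where "residue_primroot p g" using prime_primitive_root_exists[OF p1 assms(1)] by blast
  ultimately have "3 * 4 ^ m \<le> 2 ^ card {d. d dvd m} * card {\<sigma>. exponential_orthomorphism n \<sigma>}"
    unfolding m_def assms(6) using card_exponential_orthomorphisms_ge assms(1,2) by blast
  also have "\<dots> \<le> 2 ^ (2 ^ (k + 1)) * card {\<sigma>. exponential_orthomorphism n \<sigma>}"
  proof (intro mult_right_mono power_increasing)
    have "{d. d dvd (2::nat)} = {1, 2}" using two_is_prime_nat by (auto simp: prime_nat_iff)
    then have "card {d. d dvd (2::nat)} = 2" by simp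
    moreover have "(\<Prod>i = 1..k. q i) > 0" using pq by (intro prod_pos) (simp add: prime_gt_0_nat)
    ultimately have "card {d. d dvd m} \<le> 2 * card {d. d dvd (\<Prod>i = 1..k. q i)}"
      using card_divisors_mult_le[of 2 "\<Prod>i = 1..k. q i"] by (simp add: mq)
    also have "\<dots> \<le> 2 * 2 ^ k" using card_divisors_prod_primes_le[of "{1..k}" q] pq by simp
    finally show "card {d. d dvd m} \<le> 2 ^ (k + 1)" by simp
  qed auto
  finally have "real (3 * 4 ^ m) \<le> real (2 ^ (2 ^ (k + 1)) * card {\<sigma>. exponential_orthomorphism n \<sigma>})"
    by (simp only: of_nat_le_iff)
  then have N: "3 * 4 ^ m \<le> 2 ^ (2 ^ (k + 1)) * N" by (simp add: N_def)

  \<comment> \<open>\<open>h\<close> is a real power because it equals \<open>1 / 2\<close> for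
    \<open>k = 0\<close>; the bound on the number of divisors is \<open>4 * h\<close>.\<close>
  define h where "h = (2 :: real) powr (real k - 1)"
  have h: "4 * h = real (2 ^ (k + 1))" "2 * h = 2 ^ k"
    by (simp_all add: h_def powr_diff powr_realpow)
  have "(3 :: nat) ^ k \<le> (\<Prod>i = 1..k. q i)"
    using prod_mono[of "{1..k}" "\<lambda>_. 3" q] pq by simp
  then have "2 * 3 ^ k \<le> m" by (simp add: mq)
  then have "fact (k + 2) * 3 ^ k \<le> m ^ (2 * k + 1)" by (rule fact_mult_power3_le)
  then have "real (fact (k + 2) * 3 ^ k) \<le> real (m ^ (2 * k + 1))" by (simp only: of_nat_le_iff)
  then have "fact (k + 2) * 3 ^ k \<le> real m ^ (2 * k + 1)"
    by (simp only: of_nat_mult of_nat_fact of_nat_power of_nat_numeral)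
  also have "\<dots> = real m powr real (2 * k + 1)" using p1 by (subst powr_realpow) (auto simp: m_def)
  also have "\<dots> \<le> real m powr (3 * h)"
  proof (rule powr_mono)
    have "real (2 * (2 * k + 1)) \<le> real (3 * 2 ^ k)" using odd_exponent_le[of k] by (simp only: of_nat_le_iff)
    then show "real (2 * k + 1) \<le> 3 * h" using h(2) by simp
  qed (use p1 in \<open>simp add: m_def\<close>)
  finally have key: "fact (k + 2) * 3 ^ k \<le> real m powr (3 * h)" .

  have n: "real n = 2 * real m + 2" "real n - 2 = 2 * real m" using p1 by (auto simp: m_def assms(6) of_nat_diff)
  have mpos: "real m > 0" using p1 by (simp add: m_def)
  have e1: "2 powr (real n - h) = 4 * 4 ^ m / 2 powr h"
  proof -
    have "2 powr (real n) = (2 :: real) ^ n" by (simp add: powr_realpow)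
    also have "\<dots> = 2 ^ (2 * m + 2)"
    proof -
      have "n = 2 * m + 2" using p1 by (simp add: m_def assms(6))
      then show ?thesis by (rule arg_cong)
    qed
    also have "\<dots> = 4 * 4 ^ m" by (simp add: power_add power_mult)
    finally show ?thesis by (simp add: powr_diff)
  qed
  have e2: "(real n - 2) powr (3 * h) = 2 powr (3 * h) * real m powr (3 * h)"
    unfolding n(2) using mpos by (simp add: powr_mult)
  \<comment> \<open>One \<open>h\<close> comes from \<open>2 powr (real n - h)\<close> and
    \<open>3 * h\<close> from the factor \<open>2\<close> in \<open>real n - 2 = 2 * real m\<close>;
    together they give the power of two lost in the count.\<close>
  have e3: "2 powr h * 2 powr (3 * h) = (2 :: real) ^ (2 ^ (k + 1))"
  proof -
    have "2 powr h * 2 powr (3 * h) = (2 :: real) powr (4 * h)" by (simp flip: powr_add)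
    then show ?thesis by (simp only: h(1) powr_realpow)
  qed
  \<comment> \<open>This regroups the claimed bound as the lower bound already proved times a factor
    that \<open>key\<close> shows to be at most \<open>1\<close>.\<close>
  have alg: "A * 3 ^ (k + 1) * (4 * x / u) / (4 * (v * w)) = A * 3 ^ k / w * (3 * x / (u * v))"
    if "u > 0" "v > 0" "w > 0" for A x u v w :: real
    using that by (simp add: field_simps)
  have "(fact (k + 2) * 3 ^ (k + 1) * 2 powr (real n - h)) / (4 * (real n - 2) powr (3 * h))
      = (fact (k + 2) * 3 ^ k) / real m powr (3 * h) * (3 * 4 ^ m / 2 ^ (2 ^ (k + 1)))"
    unfolding e1 e2 e3[symmetric] using mpos by (intro alg) auto
  also have "\<dots> \<le> 1 * (3 * 4 ^ m / 2 ^ (2 ^ (k + 1)))"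
    using key mpos by (intro mult_right_mono) (auto simp: divide_le_eq)
  also have "\<dots> \<le> N" using N by (simp add: divide_le_eq mult.commute)
  finally show ?thesis by (simp add: h_def N_def)
qed

end
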